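(* For a DAG $G$ and parameters $P,g$, let $\mathrm{OPT}_{SPD}$, $\mathrm{OPT}_{mBSP}$, $\mathrm{OPT}_{\beta}$, $\mathrm{OPT}_{BSP}$ denote the minimum schedule cost of $G$ in the single-port duplex model, the maxBSP model (with $L=0$), the $\alpha$-$\beta$ model with $\alpha=0$, and the BSP model (with $L=0$), respectively. Then for every DAG and all parameters $P$ and $g$, $$\mathrm{OPT}_{BSP}\le 2\cdot \mathrm{OPT}_{SPD},$$ so that (since $\mathrm{OPT}_{SPD}\le\mathrm{OPT}_{mBSP}\le\mathrm{OPT}_{BSP}$ and $\mathrm{OPT}_{SPD}\le\mathrm{OPT}_{\beta}\le\mathrm{OPT}_{BSP}$) any two of these four optima differ by a factor at most $2$. Furthermore, for every $\varepsilon>0$: (a) for each of the pairs $(X,Y)\in\{(SPD,\beta),(SPD,BSP),(mBSP,\beta),(mBSP,BSP)\}$ there exist parameters $P,g$ and a DAG with $\mathrm{OPT}_{Y}\ge(2-\varepsilon)\cdot\mathrm{OPT}_{X}$; (b) for each of the pairs $(X,Y)\in\{(SPD,mBSP),(\beta,BSP),(\beta,mBSP)\}$ there exist parameters $P,g$ and a DAG with $\mathrm{OPT}_{Y}\ge(\tfrac32-\varepsilon)\cdot\mathrm{OPT}_{X}$.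
   Context: A DAG $G=(V,E)$ has unit-time nodes; $[k]=\{1,\dots,k\}$; $P$ is the number of processors, $g$ the time needed to transfer one value. Single-port duplex (SPD) model: a schedule is $\pi:V\to[P]$, $t:V\to\mathbb{Z}^+$ and $\Gamma\subseteq V\times[P]\times[P]\times\mathbb{Z}^+$, where $(v,p_1,p_2,t_0)\in\Gamma$ means $v$ is sent from $p_1$ to $p_2$ during the time interval $(t_0,t_0+g]$. Validity: no two distinct nodes on the same processor have the same $t$; every $(v,p_1,p_2,t_0)\in\Gamma$ has $t(v)\le t_0$; for two distinct elements $(v_1,p_{1,1},p_{2,1},t_1),(v_2,p_{1,2},p_{2,2},t_2)$ of $\Gamma$ whose intervals $(t_1,t_1+g]$ and $(t_2,t_2+g]$ intersect, $p_{1,1}\neq p_{1,2}$ and $p_{2,1}\neq p_{2,2}$; for $(u,v)\in E$ with $\pi(u)=\pi(v)$, $t(u)<t(v)$; for $(u,v)\in E$ with $\pi(u)\ne\pi(v)$ there is $(u,\pi(u),\pi(v),t_0)\in\Gamma$ with $t_0+g<t(v)$. Cost: $\max_v t(v)$. $\alpha$-$\beta$ model with $\alpha=0$: same as SPD, with the additional condition that for every $(u,p_1,p_2,t_0)\in\Gamma$ there is no $v\in V$ with $\pi(v)\in\{p_1,p_2\}$ and $t_0<t(v)\le t_0+g$. BSP model: a schedule with $S$ supersteps is $\pi:V\to[P]$, $\tau:V\to[S]$, $\Gamma\subseteq V\times[P]\times[P]\times[S]$ ($(v,p_1,p_2,s)$: $v$ sent from $p_1$ to $p_2$ in the communication phase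 of superstep $s$). Validity: (i) for $(u,v)\in E$, if $\pi(u)=\pi(v)$ then $\tau(u)\le\tau(v)$, otherwise $(u,\pi(u),\pi(v),s)\in\Gamma$ for some $s<\tau(v)$; (ii) each $(v,p_1,p_2,s)\in\Gamma$ has $p_1=\pi(v)$ and $\tau(v)\le s$. Costs: $C_{work}^{(s)}=\max_p|\{v:\pi(v)=p,\tau(v)=s\}|$; $C_{comm}^{(s)}=\max_p\max(C_{sent}^{(s,p)},C_{rec}^{(s,p)})$ where $C_{sent}^{(s,p)}$ ($C_{rec}^{(s,p)}$) is the number of elements of $\Gamma$ in superstep $s$ with sender (receiver) $p$; total cost $\sum_s (C_{work}^{(s)}+g\,C_{comm}^{(s)})$ (latency $L=0$); $S$ is free. maxBSP model: as BSP, except that condition (ii) requires $\tau(v)<s$ (strict), and the cost of superstep $s$ is $\max(C_{work}^{(s)},\,g\cdot C_{comm}^{(s)})$ (latency $0$); total cost is the sum over supersteps. *)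

theory Defs
  imports Complex_Main
begin

definition dag :: "'a set \<Rightarrow> 'a rel \<Rightarrow> bool" where
  "dag V E \<longleftrightarrow> finite V \<and> E \<subseteq> V \<times> V \<and> acyclic E"

text \<open>
  Throughout, \<open>P\<close> is the number of processors (named \<open>1, \<dots>, P\<close>) and \<open>g\<close> is the time to transfer
  one value. Time steps are integers, so \<open>g\<close> is a natural number. The functions \<open>\<pi>\<close>, \<open>t\<close>, \<open>\<tau>\<close> of a
  schedule only matter on \<open>V\<close>.
\<close>

definition spd_valid ::
  "'a set \<Rightarrow> 'a rel \<Rightarrow> nat \<Rightarrow> nat \<Rightarrow> ('a \<Rightarrow> nat) \<Rightarrow> ('a \<Rightarrow> nat) \<Rightarrow> ('a \<times> nat \<times> nat \<times> nat) set \<Rightarrow> bool"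
  where
  "spd_valid V E P g \<pi> t \<Gamma> \<longleftrightarrow>
     \<pi> ` V \<subseteq> {1..P} \<and> t ` V \<subseteq> {1..} \<and> \<Gamma> \<subseteq> V \<times> {1..P} \<times> {1..P} \<times> {1..} \<and>
     (\<forall>u\<in>V. \<forall>v\<in>V. u \<noteq> v \<and> \<pi> u = \<pi> v \<longrightarrow> t u \<noteq> t v) \<and>
     (\<forall>(v, p1, p2, t0)\<in>\<Gamma>. t v \<le> t0) \<and>
     (\<forall>(v1, p11, p21, t1)\<in>\<Gamma>. \<forall>(v2, p12, p22, t2)\<in>\<Gamma>.
        (v1, p11, p21, t1) \<noteq> (v2, p12, p22, t2) \<and> {t1<..t1 + g} \<inter> {t2<..t2 + g} \<noteq> {}
        \<longrightarrow> p11 \<noteq> p12 \<and> p21 \<noteq> p22) \<and>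
     (\<forall>(u, v)\<in>E. \<pi> u = \<pi> v \<longrightarrow> t u < t v) \<and>
     (\<forall>(u, v)\<in>E. \<pi> u \<noteq> \<pi> v \<longrightarrow> (\<exists>t0. (u, \<pi> u, \<pi> v, t0) \<in> \<Gamma> \<and> t0 + g < t v))"

text \<open>Inserting \<open>0\<close> only matters for the empty graph, whose schedules get cost \<open>0\<close>.\<close>

definition spd_cost :: "'a set \<Rightarrow> ('a \<Rightarrow> nat) \<Rightarrow> nat" where
  "spd_cost V t = Max (insert 0 (t ` V))"

text \<open>The alpha-beta model with \<open>\<alpha> = 0\<close>; the cost is that of the single-port duplex model.\<close>

definition beta_valid ::
  "'a set \<Rightarrow> 'a rel \<Rightarrow> nat \<Rightarrow> nat \<Rightarrow> ('a \<Rightarrow> nat) \<Rightarrow> ('a \<Rightarrow> nat) \<Rightarrow> ('a \<times> nat \<times> nat \<times> nat) set \<Rightarrow> bool"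
  where
  "beta_valid V E P g \<pi> t \<Gamma> \<longleftrightarrow>
     spd_valid V E P g \<pi> t \<Gamma> \<and>
     (\<forall>(u, p1, p2, t0)\<in>\<Gamma>. \<not> (\<exists>v\<in>V. \<pi> v \<in> {p1, p2} \<and> t0 < t v \<and> t v \<le> t0 + g))"

text \<open>The part of the validity conditions common to BSP and maxBSP; \<open>S\<close> is the number of supersteps.\<close>

definition superstep_schedule ::
  "'a set \<Rightarrow> 'a rel \<Rightarrow> nat \<Rightarrow> nat \<Rightarrow> ('a \<Rightarrow> nat) \<Rightarrow> ('a \<Rightarrow> nat) \<Rightarrow> ('a \<times> nat \<times> nat \<times> nat) set \<Rightarrow> bool"
  where
  "superstep_schedule V E P S \<pi> \<tau> \<Gamma> \<longleftrightarrow>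
     \<pi> ` V \<subseteq> {1..P} \<and> \<tau> ` V \<subseteq> {1..S} \<and> \<Gamma> \<subseteq> V \<times> {1..P} \<times> {1..P} \<times> {1..S} \<and>
     (\<forall>(u, v)\<in>E. if \<pi> u = \<pi> v then \<tau> u \<le> \<tau> v
                 else (\<exists>s. (u, \<pi> u, \<pi> v, s) \<in> \<Gamma> \<and> s < \<tau> v))"

definition bsp_valid ::
  "'a set \<Rightarrow> 'a rel \<Rightarrow> nat \<Rightarrow> nat \<Rightarrow> ('a \<Rightarrow> nat) \<Rightarrow> ('a \<Rightarrow> nat) \<Rightarrow> ('a \<times> nat \<times> nat \<times> nat) set \<Rightarrow> bool"
  where
  "bsp_valid V E P S \<pi> \<tau> \<Gamma> \<longleftrightarrow>
     superstep_schedule V E P S \<pi> \<tau> \<Gamma> \<and> (\<forall>(v, p1, p2, s)\<in>\<Gamma>. p1 = \<pi> v \<and> \<tau> v \<le> s)"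

definition mbsp_valid ::
  "'a set \<Rightarrow> 'a rel \<Rightarrow> nat \<Rightarrow> nat \<Rightarrow> ('a \<Rightarrow> nat) \<Rightarrow> ('a \<Rightarrow> nat) \<Rightarrow> ('a \<times> nat \<times> nat \<times> nat) set \<Rightarrow> bool"
  where
  "mbsp_valid V E P S \<pi> \<tau> \<Gamma> \<longleftrightarrow>
     superstep_schedule V E P S \<pi> \<tau> \<Gamma> \<and> (\<forall>(v, p1, p2, s)\<in>\<Gamma>. p1 = \<pi> v \<and> \<tau> v < s)"

definition C_work :: "'a set \<Rightarrow> nat \<Rightarrow> ('a \<Rightarrow> nat) \<Rightarrow> ('a \<Rightarrow> nat) \<Rightarrow> nat \<Rightarrow> nat" where
  "C_work V P \<pi> \<tau> s = Max ((\<lambda>p. card {v \<in> V. \<pi> v = p \<and> \<tau> v = s}) ` {1..P})"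

definition C_sent :: "('a \<times> nat \<times> nat \<times> nat) set \<Rightarrow> nat \<Rightarrow> nat \<Rightarrow> nat" where
  "C_sent \<Gamma> s p = card {(v, p1, p2, s'). (v, p1, p2, s') \<in> \<Gamma> \<and> s' = s \<and> p1 = p}"

definition C_rec :: "('a \<times> nat \<times> nat \<times> nat) set \<Rightarrow> nat \<Rightarrow> nat \<Rightarrow> nat" where
  "C_rec \<Gamma> s p = card {(v, p1, p2, s'). (v, p1, p2, s') \<in> \<Gamma> \<and> s' = s \<and> p2 = p}"

definition C_comm :: "nat \<Rightarrow> ('a \<times> nat \<times> nat \<times> nat) set \<Rightarrow> nat \<Rightarrow> nat" where
  "C_comm P \<Gamma> s = Max ((\<lambda>p. max (C_sent \<Gamma> s p) (C_rec \<Gamma> s p)) ` {1..P})"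

definition bsp_cost ::
  "'a set \<Rightarrow> nat \<Rightarrow> nat \<Rightarrow> nat \<Rightarrow> ('a \<Rightarrow> nat) \<Rightarrow> ('a \<Rightarrow> nat) \<Rightarrow> ('a \<times> nat \<times> nat \<times> nat) set \<Rightarrow> nat" where
  "bsp_cost V P g S \<pi> \<tau> \<Gamma> = (\<Sum>s=1..S. C_work V P \<pi> \<tau> s + g * C_comm P \<Gamma> s)"

definition mbsp_cost ::
  "'a set \<Rightarrow> nat \<Rightarrow> nat \<Rightarrow> nat \<Rightarrow> ('a \<Rightarrow> nat) \<Rightarrow> ('a \<Rightarrow> nat) \<Rightarrow> ('a \<times> nat \<times> nat \<times> nat) set \<Rightarrow> nat" where
  "mbsp_cost V P g S \<pi> \<tau> \<Gamma> = (\<Sum>s=1..S. max (C_work V P \<pi> \<tau> s) (g * C_comm P \<Gamma> s))"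

datatype model = SPD | MBSP | BETA | BSP

text \<open>
  Costs are natural numbers, so the minimum is attained as soon as there is a valid schedule; for
  \<open>P \<ge> 1\<close> there always is one (everything on one processor, in topological order).
\<close>

fun OPT :: "model \<Rightarrow> 'a set \<Rightarrow> 'a rel \<Rightarrow> nat \<Rightarrow> nat \<Rightarrow> nat" where
  "OPT SPD V E P g = (LEAST c. \<exists>\<pi> t \<Gamma>. spd_valid V E P g \<pi> t \<Gamma> \<and> c = spd_cost V t)"
| "OPT BETA V E P g = (LEAST c. \<exists>\<pi> t \<Gamma>. beta_valid V E P g \<pi> t \<Gamma> \<and> c = spd_cost V t)"
| "OPT MBSP V E P g =
     (LEAST c. \<exists>S \<pi> \<tau> \<Gamma>. mbsp_valid V E P S \<pi> \<tau> \<Gamma> \<and> c = mbsp_cost V P g S \<pi> \<tau> \<Gamma>)"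
| "OPT BSP V E P g =
     (LEAST c. \<exists>S \<pi> \<tau> \<Gamma>. bsp_valid V E P S \<pi> \<tau> \<Gamma> \<and> c = bsp_cost V P g S \<pi> \<tau> \<Gamma>)"

end

(*
  Upper bounds. Cutting the time axis of a single-port schedule into windows of length g gives a BSP
  schedule: transfers that start in the same window overlap, so a port is used at most once per window,
  and the last window needs no communication. Conversely, a BSP or maxBSP schedule is simulated by
  point-to-point transfers: Koenig's edge colouring theorem for bipartite multigraphs splits the
  messages of a superstep into C_comm rounds in which every port is used at most once.

  Factor 2 (g = 1, two processors). In a star with all edges directed to the centre, the processor of
  the centre must compute or receive every node. In maxBSP it can do both at the same time.

  Factor 3/2. For every j = 0, ..., g there is a group of three long sequential threads, and roughly
  at time j each thread needs one value of the preceding thread of its group. Within total cost 3 g a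
  processor can receive at most two values, which forces the threads of a group onto different
  processors; so group j communicates in a superstep that has cost j before it and g - j after it. No
  superstep fits all j, and two different ones cost g each, whence 3 g - 1; an alpha-beta schedule
  lets every group transfer at its own time and needs only 2 g + 9.
*)
theory Submission
  imports Defs
begin

subsection \<open>Edge colouring and topological order\<close>

text \<open>
  The edges on the paths that leave the left vertex \<open>x\<close> and alternate between the colours \<open>b\<close> and \<open>a\<close>.
  If \<open>a\<close> is missing at \<open>x\<close>, then exchanging the two colours on this set keeps the colouring proper
  and makes \<open>b\<close> available at \<open>x\<close>. A right vertex where \<open>b\<close> is missing is not reached: right
  vertices are entered through edges of colour \<open>b\<close>.
\<close>

inductive_set kempe :: "'e set \<Rightarrow> ('e \<Rightarrow> 'l) \<Rightarrow> ('e \<Rightarrow> 'r) \<Rightarrow> ('e \<Rightarrow> nat) \<Rightarrow> 'l \<Rightarrow> nat \<Rightarrow> nat \<Rightarrow> 'e set"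
  for M l r c x a b where
  start: "y \<in> M \<Longrightarrow> c y = b \<Longrightarrow> l y = x \<Longrightarrow> y \<in> kempe M l r c x a b"
| right: "y \<in> kempe M l r c x a b \<Longrightarrow> c y = b \<Longrightarrow> z \<in> M \<Longrightarrow> c z = a \<Longrightarrow> r z = r y
    \<Longrightarrow> z \<in> kempe M l r c x a b"
| left: "z \<in> kempe M l r c x a b \<Longrightarrow> c z = a \<Longrightarrow> y \<in> M \<Longrightarrow> c y = b \<Longrightarrow> l y = l z
    \<Longrightarrow> y \<in> kempe M l r c x a b"

lemma ex_missing_colour:
  assumes "finite F" "card F < D" "c ` F \<subseteq> {..<D}"
  obtains a where "a < D" "a \<notin> c ` F" 
proof -
  have "card (c ` F) < card {..<D}"
    using card_image_le[OF assms(1), of c] assms(2) by simp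
  then have "c ` F \<noteq> {..<D}" by auto
  then show ?thesis using assms(3) that by blast
qed

text \<open>Koenig's theorem, by induction on the edges. If colour \<open>a\<close> is missing at
  the left end of the new edge and \<open>b\<close> at its right end, exchanging both colours along
  the alternating paths from the left end makes \<open>b\<close> available at both ends.\<close>

lemma bipartite_edge_colouring:
  assumes "finite M"
    and "\<And>p. card {e \<in> M. l e = p} \<le> D" and "\<And>p. card {e \<in> M. r e = p} \<le> D"
  shows "\<exists>c. (\<forall>e\<in>M. c e < (D::nat)) \<and>
    (\<forall>e\<in>M. \<forall>f\<in>M. e \<noteq> f \<and> c e = c f \<longrightarrow> l e \<noteq> l f \<and> r e \<noteq> r f)"
  using assms
proof (induction M rule: finite_induct)
  case empty
  show ?case by simp
next
  case (insert x M)
  have mono: "card {e \<in> M. q e = p} \<le> card {e \<in> insert x M. q e = p}" for q :: "_ \<Rightarrow> 'z" and p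
    by (rule card_mono) (use insert.hyps in auto)
  have "card {e \<in> M. l e = p} \<le> D" "card {e \<in> M. r e = p'} \<le> D" for p p'
    using mono[of l p] mono[of r p'] insert.prems le_trans by blast+
  then obtain c where c: "\<And>e. e \<in> M \<Longrightarrow> c e < D"
    and proper: "\<And>e f. \<lbrakk>e \<in> M; f \<in> M; e \<noteq> f; c e = c f\<rbrakk> \<Longrightarrow> l e \<noteq> l f \<and> r e \<noteq> r f"
    using insert.IH by blast
  have less: "card {e \<in> M. q e = q x} < D" if "card {e \<in> insert x M. q e = q x} \<le> D"
    for q :: "_ \<Rightarrow> 'z"
  proof -
    have "{e \<in> insert x M. q e = q x} = insert x {e \<in> M. q e = q x}" by auto
    then show ?thesis using that insert.hyps by simp
  qed
  \<comment> \<open>Fewer than \<open>D\<close> old edges meet either end of \<open>x\<close>, since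
    \<open>x\<close> itself counts towards the bound \<open>D\<close>.\<close>
  obtain a where a: "a < D" "a \<notin> c ` {e \<in> M. l e = l x}"
    by (rule ex_missing_colour[of "{e \<in> M. l e = l x}" D c])
      (use less[of l] insert.prems insert.hyps c in auto)
  obtain b where b: "b < D" "b \<notin> c ` {e \<in> M. r e = r x}"
    by (rule ex_missing_colour[of "{e \<in> M. r e = r x}" D c])
      (use less[of r] insert.prems insert.hyps c in auto)
  define K where "K = kempe M l r c (l x) a b"
  define d where "d e = (if e = x then b else if e \<in> K then if c e = a then b else a else c e)" for e
  have KM: "e \<in> M" "c e = a \<or> c e = b" if "e \<in> K" for e
    using that unfolding K_def by (induction rule: kempe.induct) auto
  have Ka: "\<exists>y\<in>K. c y = b \<and> r y = r e" if "e \<in> K" "c e = a" "a \<noteq> b" for e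
    using that unfolding K_def by (cases rule: kempe.cases) auto
  have Kb: "l e = l x \<or> (\<exists>z\<in>K. c z = a \<and> l z = l e)" if "e \<in> K" "c e = b" "a \<noteq> b" for e
    using that unfolding K_def by (cases rule: kempe.cases) auto
  have uniq: "e = f" if "e \<in> M" "f \<in> M" "c e = c f" "l e = l f \<or> r e = r f" for e f
    using proper that by blast
  \<comment> \<open>With \<open>a = b\<close> no edge of that colour leaves \<open>l x\<close>, so
    \<open>K\<close> would be empty.\<close>
  have ab: "a \<noteq> b" if "e \<in> K" for e
  proof
    assume "a = b"
    with that have "c e = a \<and> False"
      unfolding K_def by (induction rule: kempe.induct) (use a in auto)
    then show False by simp
  qed
  \<comment> \<open>\<open>K\<close> is closed under adjacency within the two colours, so exchanging
    them on \<open>K\<close> creates no conflict at its boundary. If \<open>f\<close> meets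
    \<open>e\<close> at the end through which the path entered \<open>e\<close>, then
    \<open>f\<close> is the preceding edge of the path.\<close>
  have closed: "f \<in> K" if eK: "e \<in> K" and "f \<in> M" "c f = a \<or> c f = b" "c e \<noteq> c f" "l e = l f \<or> r e = r f" for e f
  proof (cases "c e = a")
    case True
    then have fb: "c f = b" using that by auto
    from that(5) show ?thesis
    proof
      assume "l e = l f"
      then show ?thesis using kempe.left[of e M l r c "l x" a b f] that True fb by (simp add: K_def)
    next
      assume "r e = r f"
      moreover obtain y where "y \<in> K" "c y = b" "r y = r e" using Ka[OF eK True] ab[OF eK] by blast
      ultimately show ?thesis using uniq[of y f] KM(1) that fb by auto
    qed
  next
    case False
    then have eb: "c e = b" and fa: "c f = a" using KM(2) that by auto
    from that(5) show ?thesis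
    proof
      assume "r e = r f"
      then show ?thesis using kempe.right[of e M l r c "l x" a b f] that eb fa by (simp add: K_def)
    next
      assume l: "l e = l f"
      then have "l e \<noteq> l x" using a fa that by auto
      then obtain z where "z \<in> K" "c z = a" "l z = l e" using Kb[OF eK eb] ab[OF eK] by blast
      then show ?thesis using uniq[of z f] KM(1) that fa l by auto
    qed
  qed
  \<comment> \<open>Edges of colour \<open>b\<close> at \<open>l x\<close> start paths and lose that
    colour. An edge at \<open>r x\<close> cannot gain it, since it would have been entered through
    another edge of colour \<open>b\<close> at \<open>r x\<close>.\<close>
  have new: "l e \<noteq> l x \<and> r e \<noteq> r x" if "e \<in> M" "d e = b" for e
  proof -
    have ex: "e \<noteq> x" using that insert.hyps by auto
    show ?thesis
    proof (cases "e \<in> K")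
      case True
      then have ca: "c e = a" using that ex KM(2)[OF True] ab[OF True] by (auto simp: d_def split: if_splits)
      then obtain y where "y \<in> K" "c y = b" "r y = r e" using Ka[OF True] ab True by blast
      then have "r e \<noteq> r x" using b KM(1) by force
      then show ?thesis using a ca that by auto
    next
      case False
      then have cb: "c e = b" using that ex by (auto simp: d_def)
      then have "l e \<noteq> l x" using False kempe.start[of e M c b l] that unfolding K_def by blast
      then show ?thesis using b cb that by auto
    qed
  qed
  have old: "l e \<noteq> l f \<and> r e \<noteq> r f" if "e \<in> M" "f \<in> M" "e \<noteq> f" "d e = d f" for e f
  proof (rule ccontr)
    assume "\<not> ?thesis"
    then have adj: "l e = l f \<or> r e = r f" by blast
    then have ne: "c e \<noteq> c f" using uniq that by blast
    have "e \<noteq> x" "f \<noteq> x" using that insert.hyps by auto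
    then have "e \<in> K \<or> f \<in> K"
      using that ne by (auto simp: d_def split: if_splits)
    then consider "e \<in> K" "f \<notin> K" | "f \<in> K" "e \<notin> K" | "e \<in> K" "f \<in> K"
      by blast
    then show False
    proof cases
      case 1
      then have "c f = a \<or> c f = b" using that KM(2) \<open>e \<noteq> x\<close> \<open>f \<noteq> x\<close> by (auto simp: d_def split: if_splits)
      then show False using closed[of e f] 1 that ne adj by blast
    next
      case 2
      then have "c e = a \<or> c e = b" using that KM(2) \<open>e \<noteq> x\<close> \<open>f \<noteq> x\<close> by (auto simp: d_def split: if_splits)
      then show False using closed[of f e] 2 that ne adj by metis
    next
      case 3
      then show False using that ne KM(2)[of e] KM(2)[of f] ab[of e] \<open>e \<noteq> x\<close> \<open>f \<noteq> x\<close>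
        by (auto simp: d_def split: if_splits)
    qed
  qed
  have "d e < D" if "e \<in> insert x M" for e
    using that a b c by (auto simp: d_def)
  moreover have "l e \<noteq> l f \<and> r e \<noteq> r f"
    if "e \<in> insert x M" "f \<in> insert x M" "e \<noteq> f" "d e = d f" for e f
  proof -
    have "d x = b" by (simp add: d_def)
    then show ?thesis using that new[of e] new[of f] old[of e f] by auto
  qed
  ultimately show ?case by blast
qed

text \<open>The number of ancestors grows along edges; ties are broken by an injective numbering
  \<open>h\<close> with values below \<open>n\<close>.\<close>

lemma ex_topological_index:
  assumes "dag V E"
  obtains f :: "'a \<Rightarrow> nat" where "inj_on f V" "\<And>u v. (u, v) \<in> E \<Longrightarrow> f u < f v"
proof -
  have fin: "finite V" and EV: "E \<subseteq> V \<times> V" and ac: "acyclic E"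
    using assms by (auto simp: dag_def)
  obtain h :: "'a \<Rightarrow> nat" and n where h: "h ` V = {i. i < n}" "inj_on h V"
    using finite_imp_inj_to_nat_seg[OF fin] by blast
  define d where "d v = card {w. (w, v) \<in> E\<^sup>+}" for v
  define f where "f v = d v * n + h v" for v
  have hn: "h v < n" if "v \<in> V" for v using h that by blast
  have finE: "finite {w. (w, v) \<in> E\<^sup>+}" for v
    by (rule finite_subset[OF _ fin]) (use trancl_subset_Sigma[OF EV] in auto)
  have "d u < d v" if "(u, v) \<in> E" for u v
    unfolding d_def
  proof (rule psubset_card_mono[OF finE])
    have "(u, u) \<notin> E\<^sup>+" using ac by (auto simp: acyclic_def)
    then show "{w. (w, u) \<in> E\<^sup>+} \<subset> {w. (w, v) \<in> E\<^sup>+}" using that by auto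
  qed
  then have "f u < f v" if "(u, v) \<in> E" for u v
  proof -
    have "h u < n" using that EV hn by auto
    then have "f u < Suc (d u) * n" by (simp add: f_def)
    also have "\<dots> \<le> d v * n" using \<open>(u, v) \<in> E\<close> \<open>\<And>u v. (u, v) \<in> E \<Longrightarrow> d u < d v\<close>
      by (intro mult_right_mono) (auto simp: Suc_le_eq)
    finally show ?thesis by (simp add: f_def)
  qed
  moreover have "inj_on f V"
  proof (rule inj_onI)
    fix u v assume uv: "u \<in> V" "v \<in> V" "f u = f v"
    then have "f u mod n = f v mod n" by simp
    then have "h u = h v" using hn uv by (simp add: f_def)
    then show "u = v" using h uv by (auto dest: inj_onD)
  qed
  ultimately show ?thesis using that by blast
qed

subsection \<open>From supersteps to single-port schedules\<close>

lemma C_sent_le: "p \<in> {1..P} \<Longrightarrow> C_sent \<Gamma> s p \<le> C_comm P \<Gamma> s"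
  and C_rec_le: "p \<in> {1..P} \<Longrightarrow> C_rec \<Gamma> s p \<le> C_comm P \<Gamma> s"
  unfolding C_comm_def
  by (rule order.trans[OF _ Max_ge[OF _ imageI]]; simp)+

lemma C_comm_leI:
  assumes "P \<ge> 1" "\<And>p. p \<in> {1..P} \<Longrightarrow> C_sent \<Gamma> s p \<le> k" "\<And>p. p \<in> {1..P} \<Longrightarrow> C_rec \<Gamma> s p \<le> k"
  shows "C_comm P \<Gamma> s \<le> k"
  unfolding C_comm_def using assms by (subst Max_le_iff) auto

lemma work_le_C_work: "p \<in> {1..P} \<Longrightarrow> card {v \<in> V. \<pi> v = p \<and> \<tau> v = s} \<le> C_work V P \<pi> \<tau> s"
  unfolding C_work_def by (rule Max_ge) auto

lemma C_work_leI:
  assumes "P \<ge> 1" "\<And>p. p \<in> {1..P} \<Longrightarrow> card {v \<in> V. \<pi> v = p \<and> \<tau> v = s} \<le> k"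
  shows "C_work V P \<pi> \<tau> s \<le> k"
  unfolding C_work_def using assms by (subst Max_le_iff) auto

lemma spd_cost_le: "finite V \<Longrightarrow> (\<And>v. v \<in> V \<Longrightarrow> t v \<le> c) \<Longrightarrow> spd_cost V t \<le> c"
  by (auto simp: spd_cost_def)

lemma le_spd_cost: "finite V \<Longrightarrow> v \<in> V \<Longrightarrow> t v \<le> spd_cost V t"
  by (auto simp: spd_cost_def)

text \<open>Overlap of two transfers is expressed by a common time \<open>x\<close>, which suits
  arithmetic better than a nonempty intersection of intervals.\<close>

lemma spd_validI:
  assumes "\<And>v. v \<in> V \<Longrightarrow> \<pi> v \<in> {1..P}" "\<And>v. v \<in> V \<Longrightarrow> 1 \<le> t v" "\<Gamma> \<subseteq> V \<times> {1..P} \<times> {1..P} \<times> {1..}"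
    and "\<And>u v. \<lbrakk>u \<in> V; v \<in> V; u \<noteq> v; \<pi> u = \<pi> v\<rbrakk> \<Longrightarrow> t u \<noteq> t v"
    and "\<And>v p q t0. (v, p, q, t0) \<in> \<Gamma> \<Longrightarrow> t v \<le> t0"
    and port: "\<And>v p q t1 v' p' q' t2 x. \<lbrakk>(v, p, q, t1) \<in> \<Gamma>; (v', p', q', t2) \<in> \<Gamma>;
      (v, p, q, t1) \<noteq> (v', p', q', t2); t1 < x; x \<le> t1 + g; t2 < x; x \<le> t2 + g\<rbrakk> \<Longrightarrow> p \<noteq> p' \<and> q \<noteq> q'"
    and "\<And>u v. \<lbrakk>(u, v) \<in> E; \<pi> u = \<pi> v\<rbrakk> \<Longrightarrow> t u < t v"
    and "\<And>u v. \<lbrakk>(u, v) \<in> E; \<pi> u \<noteq> \<pi> v\<rbrakk> \<Longrightarrow> \<exists>t0. (u, \<pi> u, \<pi> v, t0) \<in> \<Gamma> \<and> t0 + g < t v"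
  shows "spd_valid V E P g \<pi> t \<Gamma>"
proof -
  have "p \<noteq> p' \<and> q \<noteq> q'"
    if "(v, p, q, t1) \<in> \<Gamma>" "(v', p', q', t2) \<in> \<Gamma>" "(v, p, q, t1) \<noteq> (v', p', q', t2)"
      and ne: "{t1<..t1 + g} \<inter> {t2<..t2 + g} \<noteq> {}" for v p q t1 v' p' q' t2
  proof -
    obtain x where "x \<in> {t1<..t1 + g} \<inter> {t2<..t2 + g}" using ne by blast
    then show ?thesis using port[of v p q t1 v' p' q' t2 x] that by auto
  qed
  then have "\<forall>(v, p, q, t1)\<in>\<Gamma>. \<forall>(v', p', q', t2)\<in>\<Gamma>.
      (v, p, q, t1) \<noteq> (v', p', q', t2) \<and> {t1<..t1 + g} \<inter> {t2<..t2 + g} \<noteq> {} \<longrightarrow> p \<noteq> p' \<and> q \<noteq> q'"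
    by (simp only: Ball_def split_paired_All prod.case) blast
  then show ?thesis
    unfolding spd_valid_def using assms(1-5,7,8) by (intro conjI) (assumption | auto)+
qed

lemma mult_slot_le:
  fixes g k :: nat
  assumes "k < n" shows "g * k + g \<le> g * n"
proof -
  have "g * Suc k \<le> g * n" using assms by (intro mult_left_mono) auto
  then show ?thesis by simp
qed

text \<open>
  Superstep \<open>s\<close> occupies the time interval \<open>(T (s - 1), T s]\<close>; its messages are
  distributed over slots of length \<open>g\<close> by an edge colouring of the sender-receiver multigraph.
\<close>

lemma mbsp_to_spd:
  assumes dag: "dag V E" and P: "P \<ge> 1" and valid: "mbsp_valid V E P S \<pi> \<tau> \<Gamma>"
  obtains t \<Gamma>' where "spd_valid V E P g \<pi> t \<Gamma>'"
    and "spd_cost V t \<le> mbsp_cost V P g S \<pi> \<tau> \<Gamma>"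
    and "(\<And>v u p q. v \<in> V \<Longrightarrow> (u, p, q, \<tau> v) \<notin> \<Gamma>) \<Longrightarrow> beta_valid V E P g \<pi> t \<Gamma>'"
proof -
  have fin: "finite V" and EV: "E \<subseteq> V \<times> V" using dag by (auto simp: dag_def)
  have \<pi>: "\<And>v. v \<in> V \<Longrightarrow> \<pi> v \<in> {1..P}" and \<tau>: "\<And>v. v \<in> V \<Longrightarrow> \<tau> v \<in> {1..S}"
    and \<Gamma>: "\<Gamma> \<subseteq> V \<times> {1..P} \<times> {1..P} \<times> {1..S}"
    and loc: "\<And>u v. \<lbrakk>(u, v) \<in> E; \<pi> u = \<pi> v\<rbrakk> \<Longrightarrow> \<tau> u \<le> \<tau> v"
    and rem: "\<And>u v. \<lbrakk>(u, v) \<in> E; \<pi> u \<noteq> \<pi> v\<rbrakk> \<Longrightarrow> \<exists>s. (u, \<pi> u, \<pi> v, s) \<in> \<Gamma> \<and> s < \<tau> v"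
    and snd: "\<And>v p q s. (v, p, q, s) \<in> \<Gamma> \<Longrightarrow> p = \<pi> v \<and> \<tau> v < s"
    using valid unfolding mbsp_valid_def superstep_schedule_def
    by (auto split: if_splits simp: subset_iff)
  have fin\<Gamma>: "finite \<Gamma>" by (rule finite_subset[OF \<Gamma>]) (use fin in auto)
  obtain f :: "'a \<Rightarrow> nat" where f: "inj_on f V" "\<And>u v. (u, v) \<in> E \<Longrightarrow> f u < f v"
    using ex_topological_index[OF dag] by blast
  define c where "c s = max (C_work V P \<pi> \<tau> s) (g * C_comm P \<Gamma> s)" for s
  define T where "T s = (\<Sum>i=1..s. c i)" for s
  have T_step: "T s = T (s - 1) + c s" if "s \<ge> 1" for s
    using that by (cases s) (auto simp: T_def)
  have T_mono: "T s \<le> T s'" if "s \<le> s'" for s s'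
    unfolding T_def by (rule sum_mono2) (use that in auto)
  have cost: "mbsp_cost V P g S \<pi> \<tau> \<Gamma> = T S"
    by (simp add: mbsp_cost_def T_def c_def)
  define cls where "cls v = {w \<in> V. \<pi> w = \<pi> v \<and> \<tau> w = \<tau> v}" for v
  \<comment> \<open>The position, counted from 1, of \<open>v\<close> in topological order among the
    nodes of its processor and superstep.\<close>
  define rank where "rank v = card {w \<in> cls v. f w \<le> f v}" for v
  define t where "t v = T (\<tau> v - 1) + rank v" for v
  have rank_less: "rank u < rank v" if "u \<in> V" "v \<in> V" "\<pi> u = \<pi> v" "\<tau> u = \<tau> v" "f u < f v" for u v
    unfolding rank_def
  proof (rule psubset_card_mono)
    have "v \<in> {w \<in> cls v. f w \<le> f v}" "v \<notin> {w \<in> cls u. f w \<le> f u}"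
      using that by (auto simp: cls_def)
    moreover have "{w \<in> cls u. f w \<le> f u} \<subseteq> {w \<in> cls v. f w \<le> f v}"
      using that by (auto simp: cls_def)
    ultimately show "{w \<in> cls u. f w \<le> f u} \<subset> {w \<in> cls v. f w \<le> f v}" by blast
  qed (use fin in \<open>simp add: cls_def\<close>)
  have rank_pos: "rank v \<ge> 1" if "v \<in> V" for v
  proof -
    have "v \<in> {w \<in> cls v. f w \<le> f v}" using that by (simp add: cls_def)
    moreover have "finite {w \<in> cls v. f w \<le> f v}" using fin by (simp add: cls_def)
    ultimately show ?thesis unfolding rank_def by (metis One_nat_def Suc_leI card_gt_0_iff empty_iff)
  qed
  have t_gt: "T (\<tau> v - 1) < t v" if "v \<in> V" for v
    using rank_pos[OF that] by (simp add: t_def)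
  have t_le: "t v \<le> T (\<tau> v)" if "v \<in> V" for v
  proof -
    have "rank v \<le> card (cls v)" unfolding rank_def by (rule card_mono) (use fin in \<open>auto simp: cls_def\<close>)
    also have "\<dots> \<le> C_work V P \<pi> \<tau> (\<tau> v)"
      unfolding cls_def by (rule work_le_C_work) (use \<pi> that in blast)
    also have "\<dots> \<le> c (\<tau> v)" by (simp add: c_def)
    finally show ?thesis using T_step[of "\<tau> v"] \<tau>[OF that] by (simp add: t_def)
  qed
  have t_less: "t u < t v" if "u \<in> V" "v \<in> V" "\<tau> u < \<tau> v" for u v
    using t_le[of u] t_gt[of v] T_mono[of "\<tau> u" "\<tau> v - 1"] that by linarith
  define msgs where "msgs s = {e \<in> \<Gamma>. snd (snd (snd e)) = s}" for s
  \<comment> \<open>Senders and receivers are the two sides of a bipartite multigraph whose degrees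
    are at most \<open>C_comm\<close>.\<close>
  have "\<exists>col. (\<forall>e\<in>msgs s. col e < C_comm P \<Gamma> s) \<and>
    (\<forall>e\<in>msgs s. \<forall>f\<in>msgs s. e \<noteq> f \<and> col e = col f \<longrightarrow>
      fst (snd e) \<noteq> fst (snd f) \<and> fst (snd (snd e)) \<noteq> fst (snd (snd f)))" for s
  proof (rule bipartite_edge_colouring)
    fix p
    show "card {e \<in> msgs s. fst (snd e) = p} \<le> C_comm P \<Gamma> s"
    proof (cases "p \<in> {1..P}")
      case True
      have "card {e \<in> msgs s. fst (snd e) = p} = C_sent \<Gamma> s p"
        unfolding C_sent_def by (rule arg_cong[of _ _ card]) (auto simp: msgs_def)
      then show ?thesis using C_sent_le[OF True] by simp
    next
      case False
      then have "{e \<in> msgs s. fst (snd e) = p} = {}" using \<Gamma> by (auto simp: msgs_def)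
      then show ?thesis by (metis card.empty le0)
    qed
    show "card {e \<in> msgs s. fst (snd (snd e)) = p} \<le> C_comm P \<Gamma> s"
    proof (cases "p \<in> {1..P}")
      case True
      have "card {e \<in> msgs s. fst (snd (snd e)) = p} = C_rec \<Gamma> s p"
        unfolding C_rec_def by (rule arg_cong[of _ _ card]) (auto simp: msgs_def)
      then show ?thesis using C_rec_le[OF True] by simp
    next
      case False
      then have "{e \<in> msgs s. fst (snd (snd e)) = p} = {}" using \<Gamma> by (auto simp: msgs_def)
      then show ?thesis by (metis card.empty le0)
    qed
  qed (use fin\<Gamma> in \<open>simp add: msgs_def\<close>)
  then have "\<exists>col. \<forall>s. (\<forall>e\<in>msgs s. col s e < C_comm P \<Gamma> s) \<and>
    (\<forall>e\<in>msgs s. \<forall>f\<in>msgs s. e \<noteq> f \<and> col s e = col s f \<longrightarrow>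
      fst (snd e) \<noteq> fst (snd f) \<and> fst (snd (snd e)) \<noteq> fst (snd (snd f)))"
    by (intro choice allI)
  then obtain col where colour: "\<And>s e. e \<in> msgs s \<Longrightarrow> col s e < C_comm P \<Gamma> s"
    "\<And>s e f. \<lbrakk>e \<in> msgs s; f \<in> msgs s; e \<noteq> f; col s e = col s f\<rbrakk> \<Longrightarrow>
      fst (snd e) \<noteq> fst (snd f) \<and> fst (snd (snd e)) \<noteq> fst (snd (snd f))"
    by blast
  have msgs: "(v, p, q, s) \<in> msgs s" if "(v, p, q, s) \<in> \<Gamma>" for v p q s
    using that by (simp add: msgs_def)
  have col: "col s (v, p, q, s) < C_comm P \<Gamma> s" if "(v, p, q, s) \<in> \<Gamma>" for v p q s
    by (rule colour(1)[OF msgs[OF that]])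
  have col': "p \<noteq> p' \<and> q \<noteq> q'"
    if "(v, p, q, s) \<in> \<Gamma>" "(v', p', q', s) \<in> \<Gamma>" "(v, p, q) \<noteq> (v', p', q')"
      "col s (v, p, q, s) = col s (v', p', q', s)" for v p q v' p' q' s
    using colour(2)[OF msgs[OF that(1)] msgs[OF that(2)] _ that(4)] that(3) by simp
  \<comment> \<open>The colour of a message is the index of its slot within the superstep.\<close>
  define start where "start v p q s = T (s - 1) + g * col s (v, p, q, s)" for v p q s
  define \<Gamma>' where "\<Gamma>' = {(v, p, q, start v p q s) | v p q s. (v, p, q, s) \<in> \<Gamma>}"
  have start_ge: "T (s - 1) \<le> start v p q s" for v p q s by (simp add: start_def)
  have start_le: "start v p q s + g \<le> T s" if "(v, p, q, s) \<in> \<Gamma>" for v p q s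
  proof -
    have "g * col s (v, p, q, s) + g \<le> g * C_comm P \<Gamma> s" by (rule mult_slot_le[OF col[OF that]])
    also have "\<dots> \<le> c s" by (simp add: c_def)
    finally show ?thesis using T_step[of s] \<Gamma> that by (auto simp: start_def)
  qed
  \<comment> \<open>By the strict inequality in maxBSP validity, the superstep of \<open>v\<close>
    is over when superstep \<open>s\<close> begins.\<close>
  have t_le_start: "t v \<le> start v p q s" if "(v, p, q, s) \<in> \<Gamma>" for v p q s
    using t_le[of v] T_mono[of "\<tau> v" "s - 1"] start_ge[of s v p q] snd[OF that] \<Gamma> that by force
  have port: "p \<noteq> p' \<and> q \<noteq> q'"
    if m: "(v, p, q, s) \<in> \<Gamma>" "(v', p', q', s') \<in> \<Gamma>" and ne: "(v, p, q, s) \<noteq> (v', p', q', s')"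
      and x: "x \<in> {start v p q s<..start v p q s + g}" "x \<in> {start v' p' q' s'<..start v' p' q' s' + g}"
    for v p q s v' p' q' s' x
  proof -
    \<comment> \<open>A common time \<open>x\<close> forces the same superstep and then the same
      slot, because distinct supersteps and distinct slots occupy disjoint intervals.\<close>
    have "x \<in> {T (s - 1)<..T s}" "x \<in> {T (s' - 1)<..T s'}"
      using x start_le[OF m(1)] start_le[OF m(2)] start_ge[of s v p q] start_ge[of s' v' p' q'] by auto
    then have "\<not> s < s'" "\<not> s' < s" using T_mono[of s "s' - 1"] T_mono[of s' "s - 1"] by force+
    then have s: "s' = s" by simp
    have "col s (v, p, q, s) = col s (v', p', q', s)"
    proof (rule ccontr)
      assume "\<not> ?thesis"
      then have "g * col s (v, p, q, s) + g \<le> g * col s (v', p', q', s) \<or>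
        g * col s (v', p', q', s) + g \<le> g * col s (v, p, q, s)"
        using mult_slot_le nat_neq_iff by metis
      then show False using x by (auto simp: start_def s)
    qed
    then show ?thesis using col'[of v p q s v' p' q'] m ne s by blast
  qed
  have spd: "spd_valid V E P g \<pi> t \<Gamma>'"
  proof (rule spd_validI)
    show "\<pi> v \<in> {1..P}" "1 \<le> t v" if "v \<in> V" for v
      using \<pi>[OF that] t_gt[OF that] by auto
    have "1 \<le> start v p q s" if "(v, p, q, s) \<in> \<Gamma>" for v p q s
      using t_le_start[OF that] t_gt[of v] \<Gamma> that by force
    then show "\<Gamma>' \<subseteq> V \<times> {1..P} \<times> {1..P} \<times> {1..}" using \<Gamma> by (fastforce simp: \<Gamma>'_def)
    show "t u \<noteq> t v" if uv: "u \<in> V" "v \<in> V" "u \<noteq> v" "\<pi> u = \<pi> v" for u v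
    proof -
      have "f u < f v \<or> f v < f u" using f(1) uv by (meson inj_onD nat_neq_iff)
      then show "t u \<noteq> t v"
        using t_less[of u v] t_less[of v u] rank_less[of u v] rank_less[of v u] uv
        by (cases "\<tau> u" "\<tau> v" rule: linorder_cases) (auto simp: t_def)
    qed
    show "t v \<le> t0" if "(v, p, q, t0) \<in> \<Gamma>'" for v p q t0
      using t_le_start that by (auto simp: \<Gamma>'_def)
    show "p \<noteq> p' \<and> q \<noteq> q'"
      if m: "(v, p, q, t1) \<in> \<Gamma>'" "(v', p', q', t2) \<in> \<Gamma>'" and ne: "(v, p, q, t1) \<noteq> (v', p', q', t2)"
        and x: "t1 < x" "x \<le> t1 + g" "t2 < x" "x \<le> t2 + g" for v p q t1 v' p' q' t2 x
    proof -
      obtain s s' where "(v, p, q, s) \<in> \<Gamma>" "t1 = start v p q s" "(v', p', q', s') \<in> \<Gamma>" "t2 = start v' p' q' s'"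
        using m by (auto simp: \<Gamma>'_def)
      then show ?thesis using port[of v p q s v' p' q' s' x] ne x by auto
    qed
    fix u v assume e: "(u, v) \<in> E"
    then have V: "u \<in> V" "v \<in> V" using EV by auto
    show "t u < t v" if "\<pi> u = \<pi> v"
      using loc[OF e that] f(2)[OF e] rank_less[of u v] t_less[of u v] that V
      by (cases "\<tau> u = \<tau> v") (auto simp: t_def)
    show "\<exists>t0. (u, \<pi> u, \<pi> v, t0) \<in> \<Gamma>' \<and> t0 + g < t v" if ne: "\<pi> u \<noteq> \<pi> v"
    proof -
      obtain s where s: "(u, \<pi> u, \<pi> v, s) \<in> \<Gamma>" "s < \<tau> v" using rem[OF e ne] by blast
      have "start u (\<pi> u) (\<pi> v) s + g < t v"
        using start_le[OF s(1)] T_mono[of s "\<tau> v - 1"] t_gt[of v] s V by force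
      then show ?thesis using s by (auto simp: \<Gamma>'_def)
    qed
  qed
  have "spd_cost V t \<le> T S"
  proof (rule spd_cost_le[OF fin])
    show "t v \<le> T S" if "v \<in> V" for v
      using t_le[OF that] T_mono[of "\<tau> v" S] \<tau>[OF that] by simp
  qed
  moreover have "beta_valid V E P g \<pi> t \<Gamma>'" if sep: "\<And>v u p q. v \<in> V \<Longrightarrow> (u, p, q, \<tau> v) \<notin> \<Gamma>"
    unfolding beta_valid_def
  proof (intro conjI spd, clarify)
    fix u p q t0 v
    assume "(u, p, q, t0) \<in> \<Gamma>'" and v: "v \<in> V" "t0 < t v" "t v \<le> t0 + g"
    then obtain s where s: "(u, p, q, s) \<in> \<Gamma>" "t0 = start u p q s" by (auto simp: \<Gamma>'_def)
    \<comment> \<open>A node that runs during a transfer of superstep \<open>s\<close> is itself in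
      superstep \<open>s\<close>, contrary to \<open>sep\<close>.\<close>
    have "T (s - 1) < t v" "t v \<le> T s" using start_le[OF s(1)] start_ge[of s u p q] s(2) v by auto
    then have "\<not> s < \<tau> v" "\<not> \<tau> v < s"
      using t_le[OF v(1)] t_gt[OF v(1)] T_mono[of s "\<tau> v - 1"] T_mono[of "\<tau> v" "s - 1"] by force+
    then show False using s sep[OF v(1), of u p q] by simp
  qed
  ultimately show ?thesis using that spd cost by simp
qed

subsection \<open>Superstep schedules from BSP and single-port schedules\<close>

text \<open>Elimination form of \<open>spd_validI\<close>, with the port condition contraposed:
  transfers sharing a port and a time \<open>x\<close> are equal.\<close>

lemma spd_validD:
  assumes "spd_valid V E P g \<pi> t \<Gamma>"
  shows "v \<in> V \<Longrightarrow> \<pi> v \<in> {1..P}" "v \<in> V \<Longrightarrow> 1 \<le> t v" "\<Gamma> \<subseteq> V \<times> {1..P} \<times> {1..P} \<times> {1..}"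
    and "\<lbrakk>u \<in> V; v \<in> V; \<pi> u = \<pi> v; t u = t v\<rbrakk> \<Longrightarrow> u = v"
    and "(v, p, q, t0) \<in> \<Gamma> \<Longrightarrow> t v \<le> t0"
    and "\<lbrakk>(v, p, q, t1) \<in> \<Gamma>; (v', p', q', t2) \<in> \<Gamma>; p = p' \<or> q = q';
      t1 < x; x \<le> t1 + g; t2 < x; x \<le> t2 + g\<rbrakk> \<Longrightarrow> (v, p, q, t1) = (v', p', q', t2)"
    and "\<lbrakk>(u, v) \<in> E; \<pi> u = \<pi> v\<rbrakk> \<Longrightarrow> t u < t v"
    and "\<lbrakk>(u, v) \<in> E; \<pi> u \<noteq> \<pi> v\<rbrakk> \<Longrightarrow> \<exists>t0. (u, \<pi> u, \<pi> v, t0) \<in> \<Gamma> \<and> t0 + g < t v"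
proof -
  have "\<pi> ` V \<subseteq> {1..P}" "t ` V \<subseteq> {1..}"
    and \<Gamma>: "\<Gamma> \<subseteq> V \<times> {1..P} \<times> {1..P} \<times> {1..}"
    and inj: "\<forall>u\<in>V. \<forall>v\<in>V. u \<noteq> v \<and> \<pi> u = \<pi> v \<longrightarrow> t u \<noteq> t v"
    and snd: "\<forall>(v, p1, p2, t0)\<in>\<Gamma>. t v \<le> t0"
    and port: "\<forall>(v1, p11, p21, t1)\<in>\<Gamma>. \<forall>(v2, p12, p22, t2)\<in>\<Gamma>.
      (v1, p11, p21, t1) \<noteq> (v2, p12, p22, t2) \<and> {t1<..t1 + g} \<inter> {t2<..t2 + g} \<noteq> {}
      \<longrightarrow> p11 \<noteq> p12 \<and> p21 \<noteq> p22"
    and loc: "\<forall>(u, v)\<in>E. \<pi> u = \<pi> v \<longrightarrow> t u < t v"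
    and rem: "\<forall>(u, v)\<in>E. \<pi> u \<noteq> \<pi> v \<longrightarrow> (\<exists>t0. (u, \<pi> u, \<pi> v, t0) \<in> \<Gamma> \<and> t0 + g < t v)"
    using assms unfolding spd_valid_def by - (elim conjE, assumption)+
  then show "v \<in> V \<Longrightarrow> \<pi> v \<in> {1..P}" "v \<in> V \<Longrightarrow> 1 \<le> t v" by auto
  show "\<Gamma> \<subseteq> V \<times> {1..P} \<times> {1..P} \<times> {1..}" by (fact \<Gamma>)
  show "\<lbrakk>u \<in> V; v \<in> V; \<pi> u = \<pi> v; t u = t v\<rbrakk> \<Longrightarrow> u = v" using inj by blast
  show "(v, p, q, t0) \<in> \<Gamma> \<Longrightarrow> t v \<le> t0" using snd by blast
  show "\<lbrakk>(u, v) \<in> E; \<pi> u = \<pi> v\<rbrakk> \<Longrightarrow> t u < t v" using loc by blast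
  show "\<lbrakk>(u, v) \<in> E; \<pi> u \<noteq> \<pi> v\<rbrakk> \<Longrightarrow> \<exists>t0. (u, \<pi> u, \<pi> v, t0) \<in> \<Gamma> \<and> t0 + g < t v" using rem by blast
  show "(v, p, q, t1) = (v', p', q', t2)"
    if m: "(v, p, q, t1) \<in> \<Gamma>" "(v', p', q', t2) \<in> \<Gamma>" and "p = p' \<or> q = q'"
      "t1 < x" "x \<le> t1 + g" "t2 < x" "x \<le> t2 + g"
  proof -
    have "x \<in> {t1<..t1 + g} \<inter> {t2<..t2 + g}" using that by simp
    then show ?thesis using bspec[OF bspec[OF port m(1), unfolded prod.case] m(2)] that by blast
  qed
qed

section \<open>Counting messages and handling superstep schedules\<close>

lemma C_sent_eq: "C_sent \<Gamma> s p = card {(v, q). (v, p, q, s) \<in> \<Gamma>}"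
  and C_rec_eq: "C_rec \<Gamma> s q = card {(v, p). (v, p, q, s) \<in> \<Gamma>}"
proof -
  have "{(v, p1, p2, s'). (v, p1, p2, s') \<in> \<Gamma> \<and> s' = s \<and> p1 = p} =
      (\<lambda>(v, q). (v, p, q, s)) ` {(v, q). (v, p, q, s) \<in> \<Gamma>}" by auto
  then show "C_sent \<Gamma> s p = card {(v, q). (v, p, q, s) \<in> \<Gamma>}"
    unfolding C_sent_def by (simp add: card_image inj_on_def split_def prod_eq_iff)
  have "{(v, p1, p2, s'). (v, p1, p2, s') \<in> \<Gamma> \<and> s' = s \<and> p2 = q} =
      (\<lambda>(v, p). (v, p, q, s)) ` {(v, p). (v, p, q, s) \<in> \<Gamma>}" by auto
  then show "C_rec \<Gamma> s q = card {(v, p). (v, p, q, s) \<in> \<Gamma>}"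
    unfolding C_rec_def by (simp add: card_image inj_on_def split_def prod_eq_iff)
qed

lemma C_comm_eq_0:
  assumes "P \<ge> 1" "\<And>v p q. (v, p, q, s) \<notin> \<Gamma>"
  shows "C_comm P \<Gamma> s = 0"
proof -
  have "C_comm P \<Gamma> s \<le> 0"
    by (rule C_comm_leI[OF assms(1)]) (simp_all add: C_sent_eq C_rec_eq assms(2))
  then show ?thesis by simp
qed

lemma superstep_scheduleI:
  assumes "\<And>v. v \<in> V \<Longrightarrow> \<pi> v \<in> {1..P}" "\<And>v. v \<in> V \<Longrightarrow> \<tau> v \<in> {1..S}"
    and "\<Gamma> \<subseteq> V \<times> {1..P} \<times> {1..P} \<times> {1..S}"
    and "\<And>u v. \<lbrakk>(u, v) \<in> E; \<pi> u = \<pi> v\<rbrakk> \<Longrightarrow> \<tau> u \<le> \<tau> v"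
    and "\<And>u v. \<lbrakk>(u, v) \<in> E; \<pi> u \<noteq> \<pi> v\<rbrakk> \<Longrightarrow> \<exists>s. (u, \<pi> u, \<pi> v, s) \<in> \<Gamma> \<and> s < \<tau> v"
  shows "superstep_schedule V E P S \<pi> \<tau> \<Gamma>"
  unfolding superstep_schedule_def using assms by auto

lemma superstep_scheduleD:
  assumes "superstep_schedule V E P S \<pi> \<tau> \<Gamma>"
  shows "v \<in> V \<Longrightarrow> \<pi> v \<in> {1..P}" "v \<in> V \<Longrightarrow> \<tau> v \<in> {1..S}"
    and "\<Gamma> \<subseteq> V \<times> {1..P} \<times> {1..P} \<times> {1..S}"
    and "\<lbrakk>(u, v) \<in> E; \<pi> u = \<pi> v\<rbrakk> \<Longrightarrow> \<tau> u \<le> \<tau> v"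
    and "\<lbrakk>(u, v) \<in> E; \<pi> u \<noteq> \<pi> v\<rbrakk> \<Longrightarrow> \<exists>s. (u, \<pi> u, \<pi> v, s) \<in> \<Gamma> \<and> s < \<tau> v"
  using assms unfolding superstep_schedule_def by (auto split: if_splits simp: subset_iff)

lemma card_le_oneI: "(\<And>x y. \<lbrakk>x \<in> A; y \<in> A\<rbrakk> \<Longrightarrow> x = y) \<Longrightarrow> card A \<le> 1"
  by (cases "finite A") (auto simp: card_le_Suc0_iff_eq)

lemma div_eq_imp_less:
  fixes x y g :: nat
  assumes "g \<ge> 1" "x div g = y div g"
  shows "x < y + g"
proof -
  have "g * (x div g) + x mod g = x" "g * (y div g) + y mod g = y" by (rule mult_div_mod_eq)+
  moreover have "x mod g < g" using assms(1) by simp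
  ultimately show ?thesis unfolding assms(2) by linarith
qed

lemma sum_pairs: "(\<Sum>i=1..2 * S. f i) = (\<Sum>s=1..S. f (2 * s - 1) + f (2 * s :: nat) :: nat)"
  by (induction S) auto

text \<open>Superstep \<open>s\<close> splits into \<open>2 * s - 1\<close> for the work and
  \<open>2 * s\<close> for the messages, which gives the strict inequality of maxBSP without raising
  the cost. The last conclusion, that work and messages never share a superstep, leads to the
  alpha-beta model.\<close>

lemma bsp_to_mbsp:
  assumes P: "P \<ge> 1" and valid: "bsp_valid V E P S \<pi> \<tau> \<Gamma>"
  obtains \<tau>' \<Gamma>' where "mbsp_valid V E P (2 * S) \<pi> \<tau>' \<Gamma>'"
    and "mbsp_cost V P g (2 * S) \<pi> \<tau>' \<Gamma>' \<le> bsp_cost V P g S \<pi> \<tau> \<Gamma>"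
    and "\<And>v u p q. v \<in> V \<Longrightarrow> (u, p, q, \<tau>' v) \<notin> \<Gamma>'"
proof -
  have sched: "superstep_schedule V E P S \<pi> \<tau> \<Gamma>"
    and snd: "\<And>v p q s. (v, p, q, s) \<in> \<Gamma> \<Longrightarrow> p = \<pi> v \<and> \<tau> v \<le> s"
    using valid by (auto simp: bsp_valid_def)
  note sched = superstep_scheduleD[OF sched]
  define \<tau>' where "\<tau>' v = 2 * \<tau> v - 1" for v
  define \<Gamma>' where "\<Gamma>' = {(v, p, q, 2 * s) | v p q s. (v, p, q, s) \<in> \<Gamma>}"
  have \<tau>_pos: "\<tau> v \<ge> 1" if "v \<in> V" for v using sched(2)[OF that] by simp
  have odd: "2 * a - 1 \<noteq> 2 * b" if "a \<ge> 1" for a b :: nat using that by presburger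
  have "mbsp_valid V E P (2 * S) \<pi> \<tau>' \<Gamma>'"
    unfolding mbsp_valid_def
  proof (intro conjI superstep_scheduleI)
    show "\<pi> v \<in> {1..P}" "\<tau>' v \<in> {1..2 * S}" if "v \<in> V" for v
      using sched(1,2)[OF that] by (auto simp: \<tau>'_def)
    show "\<Gamma>' \<subseteq> V \<times> {1..P} \<times> {1..P} \<times> {1..2 * S}" using sched(3) by (fastforce simp: \<Gamma>'_def)
    show "\<tau>' u \<le> \<tau>' v" if "(u, v) \<in> E" "\<pi> u = \<pi> v" for u v
      using sched(4)[OF that] by (simp add: \<tau>'_def)
    show "\<exists>s. (u, \<pi> u, \<pi> v, s) \<in> \<Gamma>' \<and> s < \<tau>' v" if e: "(u, v) \<in> E" "\<pi> u \<noteq> \<pi> v" for u v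
    proof -
      obtain s where "(u, \<pi> u, \<pi> v, s) \<in> \<Gamma>" "s < \<tau> v" using sched(5)[OF e] by blast
      then have "(u, \<pi> u, \<pi> v, 2 * s) \<in> \<Gamma>'" "2 * s < \<tau>' v" by (auto simp: \<Gamma>'_def \<tau>'_def)
      then show ?thesis by blast
    qed
    have "p = \<pi> v \<and> \<tau>' v < 2 * s" if "(v, p, q, s) \<in> \<Gamma>" for v p q s
      using snd[OF that] \<tau>_pos[of v] sched(3) that by (auto simp: \<tau>'_def)
    then show "\<forall>(v, p1, p2, s)\<in>\<Gamma>'. p1 = \<pi> v \<and> \<tau>' v < s" by (auto simp: \<Gamma>'_def)
  qed
  moreover have "(u, p, q, \<tau>' v) \<notin> \<Gamma>'" if "v \<in> V" for v u p q
    using odd[OF \<tau>_pos[OF that]] by (auto simp: \<Gamma>'_def \<tau>'_def)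
  moreover have "mbsp_cost V P g (2 * S) \<pi> \<tau>' \<Gamma>' \<le> bsp_cost V P g S \<pi> \<tau> \<Gamma>"
    unfolding mbsp_cost_def bsp_cost_def sum_pairs
  proof (rule sum_mono, rule add_mono)
    fix s assume s: "s \<in> {1..S}"
    have "C_work V P \<pi> \<tau>' (2 * s - 1) \<le> C_work V P \<pi> \<tau> s"
    proof (rule C_work_leI[OF P])
      fix p assume p: "p \<in> {1..P}"
      have "{v \<in> V. \<pi> v = p \<and> \<tau>' v = 2 * s - 1} = {v \<in> V. \<pi> v = p \<and> \<tau> v = s}"
        using \<tau>_pos s by (force simp: \<tau>'_def)
      then show "card {v \<in> V. \<pi> v = p \<and> \<tau>' v = 2 * s - 1} \<le> C_work V P \<pi> \<tau> s"
        using work_le_C_work[OF p] by metis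
    qed
    moreover have "C_comm P \<Gamma>' (2 * s - 1) = 0"
    proof (rule C_comm_eq_0[OF P])
      show "(v, p, q, 2 * s - 1) \<notin> \<Gamma>'" for v p q using s odd by (auto simp: \<Gamma>'_def)
    qed
    ultimately show "max (C_work V P \<pi> \<tau>' (2 * s - 1)) (g * C_comm P \<Gamma>' (2 * s - 1)) \<le> C_work V P \<pi> \<tau> s"
      by simp
    have "C_work V P \<pi> \<tau>' (2 * s) \<le> 0"
    proof (rule C_work_leI[OF P])
      fix p
      have "{v \<in> V. \<pi> v = p \<and> \<tau>' v = 2 * s} = {}" using \<tau>_pos odd by (auto simp: \<tau>'_def)
      then show "card {v \<in> V. \<pi> v = p \<and> \<tau>' v = 2 * s} \<le> 0" by (metis card.empty le0)
    qed
    moreover have "C_comm P \<Gamma>' (2 * s) \<le> C_comm P \<Gamma> s"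
    proof (rule C_comm_leI[OF P])
      fix p assume p: "p \<in> {1..P}"
      have "(v, p, q, 2 * s) \<in> \<Gamma>' \<longleftrightarrow> (v, p, q, s) \<in> \<Gamma>" for v p q by (auto simp: \<Gamma>'_def)
      then have "C_sent \<Gamma>' (2 * s) p = C_sent \<Gamma> s p" "C_rec \<Gamma>' (2 * s) p = C_rec \<Gamma> s p"
        by (simp_all only: C_sent_eq C_rec_eq)
      then show "C_sent \<Gamma>' (2 * s) p \<le> C_comm P \<Gamma> s" "C_rec \<Gamma>' (2 * s) p \<le> C_comm P \<Gamma> s"
        using C_sent_le[OF p, of \<Gamma> s] C_rec_le[OF p, of \<Gamma> s] by simp_all
    qed
    ultimately show "max (C_work V P \<pi> \<tau>' (2 * s)) (g * C_comm P \<Gamma>' (2 * s)) \<le> g * C_comm P \<Gamma> s"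
      by simp
  qed
  ultimately show ?thesis using that by blast
qed

text \<open>
  Cut the time axis into windows of length \<open>h = max 1 g\<close> and make each window a superstep. Transfers
  that start in the same window overlap, so each port is used at most once per superstep. Nothing
  needs to be sent in the last superstep, which is what keeps the cost within twice the length of
  the schedule even if the last window is incomplete.
\<close>

lemma spd_to_bsp:
  assumes dag: "dag V E" and P: "P \<ge> 1" and valid: "spd_valid V E P g \<pi> t \<Gamma>"
  obtains S \<tau> \<Gamma>' where "bsp_valid V E P S \<pi> \<tau> \<Gamma>'"
    and "bsp_cost V P g S \<pi> \<tau> \<Gamma>' \<le> 2 * spd_cost V t"
proof -
  have fin: "finite V" and EV: "E \<subseteq> V \<times> V" using dag by (auto simp: dag_def)
  note spd = spd_validD[OF valid]
  define C where "C = spd_cost V t"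
  \<comment> \<open>The maximum with 1 keeps the division meaningful for
    \<open>g = 0\<close>.\<close>
  define h where "h = max 1 g"
  have h: "h \<ge> 1" "g \<le> h" by (auto simp: h_def)
  \<comment> \<open>For \<open>x \<ge> 1\<close> this is the index, counted from 1, of the window
    that contains time \<open>x\<close>.\<close>
  define win where "win x = (x - 1 + h) div h" for x
  define S where "S = win C"
  define \<tau> where "\<tau> v = win (t v)" for v
  \<comment> \<open>For \<open>g \<ge> 1\<close> this is \<open>win (t0 + 1)\<close>, the window of
    the first time unit of the transfer.\<close>
  define start_win where "start_win t0 = (t0 + g) div h" for t0
  \<comment> \<open>In BSP only the owner of a value sends it, whereas single-port transfers may
    forward values. A message in superstep \<open>S\<close> would come too late for every node and
    is dropped.\<close>
  define \<Gamma>' where "\<Gamma>' = {(v, p, q, start_win t0) | v p q t0. (v, p, q, t0) \<in> \<Gamma> \<and> p = \<pi> v \<and> start_win t0 < S}"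
  have win_mono: "win x \<le> win y" if "x \<le> y" for x y
    unfolding win_def by (rule div_le_mono) (use that in simp)
  have win_pos: "1 \<le> win x" for x
    using div_le_mono[of h "x - 1 + h" h] h by (simp add: win_def)
  have \<tau>: "\<tau> v \<in> {1..S}" if "v \<in> V" for v
    using win_pos[of "t v"] win_mono[OF le_spd_cost[OF fin that, of t]] that
    by (simp add: \<tau>_def S_def C_def)
  have \<tau>_le: "\<tau> v \<le> start_win t0" if "(v, p, q, t0) \<in> \<Gamma>" for v p q t0
    unfolding \<tau>_def win_def start_win_def
    by (rule div_le_mono) (use spd(5)[OF that] spd(2)[of v] spd(3) that in \<open>auto simp: h_def\<close>)
  have start_less: "start_win t0 < win x" if "t0 + g < x" for t0 x
  proof -
    have "(t0 + g + h) div h \<le> win x" unfolding win_def by (rule div_le_mono) (use that in simp)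
    then show ?thesis using h by (simp add: start_win_def)
  qed
  have "bsp_valid V E P S \<pi> \<tau> \<Gamma>'"
    unfolding bsp_valid_def
  proof (intro conjI superstep_scheduleI)
    show "\<Gamma>' \<subseteq> V \<times> {1..P} \<times> {1..P} \<times> {1..S}"
    proof -
      have "1 \<le> start_win t0" if "(v, p, q, t0) \<in> \<Gamma>" for v p q t0
        using \<tau>_le[OF that] \<tau>[of v] spd(3) that by fastforce
      then show ?thesis using spd(3) by (fastforce simp: \<Gamma>'_def)
    qed
    show "\<tau> u \<le> \<tau> v" if "(u, v) \<in> E" "\<pi> u = \<pi> v" for u v
      using win_mono spd(7)[OF that] by (simp add: \<tau>_def)
    show "\<exists>s. (u, \<pi> u, \<pi> v, s) \<in> \<Gamma>' \<and> s < \<tau> v" if e: "(u, v) \<in> E" "\<pi> u \<noteq> \<pi> v" for u v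
    proof -
      obtain t0 where t0: "(u, \<pi> u, \<pi> v, t0) \<in> \<Gamma>" "t0 + g < t v" using spd(8)[OF e] by blast
      then have "start_win t0 < \<tau> v" using start_less by (simp add: \<tau>_def)
      moreover have "\<tau> v \<le> S" using \<tau>[of v] e EV by auto
      ultimately show ?thesis using t0 unfolding \<Gamma>'_def by fastforce
    qed
    show "\<forall>(v, p1, p2, s)\<in>\<Gamma>'. p1 = \<pi> v \<and> \<tau> v \<le> s" using \<tau>_le by (auto simp: \<Gamma>'_def)
  qed (use spd(1) \<tau> in auto)
  moreover have "bsp_cost V P g S \<pi> \<tau> \<Gamma>' \<le> 2 * C"
  proof (cases "C = 0")
    case True
    then have "V = {}" using le_spd_cost[OF fin, of _ t] spd(2) unfolding C_def by fastforce
    moreover have "\<Gamma>' = {}" using spd(3) \<open>V = {}\<close> by (auto simp: \<Gamma>'_def)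
    ultimately have "C_work V P \<pi> \<tau> s \<le> 0" "C_comm P \<Gamma>' s = 0" for s
      by (auto intro: C_work_leI[OF P, of _ _ _ _ 0, simplified] C_comm_eq_0[OF P])
    then show ?thesis by (simp add: bsp_cost_def)
  next
    case False
    \<comment> \<open>Times on one processor are distinct, so \<open>t\<close> maps its nodes in
      superstep \<open>s\<close> injectively into window \<open>s\<close>; the windows partition
      \<open>{1..C}\<close>.\<close>
    have "C_work V P \<pi> \<tau> s \<le> card {x \<in> {1..C}. win x = s}" for s
    proof (rule C_work_leI[OF P])
      fix p
      show "card {v \<in> V. \<pi> v = p \<and> \<tau> v = s} \<le> card {x \<in> {1..C}. win x = s}"
      proof (rule card_inj_on_le[of t])
        show "inj_on t {v \<in> V. \<pi> v = p \<and> \<tau> v = s}" using spd(4) by (auto intro: inj_onI)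
        show "t ` {v \<in> V. \<pi> v = p \<and> \<tau> v = s} \<subseteq> {x \<in> {1..C}. win x = s}"
          using spd(2) le_spd_cost[OF fin, of _ t] by (auto simp: \<tau>_def C_def)
      qed simp
    qed
    then have "(\<Sum>s=1..S. C_work V P \<pi> \<tau> s) \<le> (\<Sum>s=1..S. card {x \<in> {1..C}. win x = s})"
      by (rule sum_mono)
    also have "\<dots> = card {1..C}"
    proof -
      have "(\<Sum>s\<in>{1..S}. \<Sum>x\<in>{x \<in> {1..C}. win x = s}. 1 :: nat) = (\<Sum>x\<in>{1..C}. 1)"
        by (rule sum.group) (use win_pos win_mono in \<open>auto simp: S_def\<close>)
      then show ?thesis by simp
    qed
    finally have work: "(\<Sum>s=1..S. C_work V P \<pi> \<tau> s) \<le> C" by simp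
    have comm: "g * C_comm P \<Gamma>' s \<le> (if s < S then g else 0)" for s
    proof (cases "s < S \<and> g \<ge> 1")
      case True
      have same: "e = f" if ef: "e \<in> \<Gamma>'" "f \<in> \<Gamma>'" and "snd (snd (snd e)) = s" "snd (snd (snd f)) = s"
        "fst (snd e) = fst (snd f) \<or> fst (snd (snd e)) = fst (snd (snd f))" for e f
      proof -
        obtain v p q t1 where e: "e = (v, p, q, start_win t1)" "(v, p, q, t1) \<in> \<Gamma>"
          using ef(1) by (auto simp: \<Gamma>'_def)
        obtain v' p' q' t2 where f: "f = (v', p', q', start_win t2)" "(v', p', q', t2) \<in> \<Gamma>"
          using ef(2) by (auto simp: \<Gamma>'_def)
        have hg: "h = g" using True by (simp add: h_def)
        have "t1 div g = t2 div g" using that e f True by (simp add: start_win_def hg)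
        then have "t1 < t2 + g" "t2 < t1 + g" using True div_eq_imp_less[of g] by metis+
        moreover have "p = p' \<or> q = q'" using that(5) e f by simp
        \<comment> \<open>Both transfers are under way at time \<open>max t1 t2 + 1\<close>, so a
          shared port makes them equal.\<close>
        ultimately have "(v, p, q, t1) = (v', p', q', t2)"
          using True by (intro spd(6)[OF e(2) f(2), of "max t1 t2 + 1"]) auto
        then show ?thesis using e f by simp
      qed
      have "C_comm P \<Gamma>' s \<le> 1"
      proof (rule C_comm_leI[OF P])
        fix p
        show "C_sent \<Gamma>' s p \<le> 1" unfolding C_sent_def by (rule card_le_oneI, rule same) auto
        show "C_rec \<Gamma>' s p \<le> 1" unfolding C_rec_def by (rule card_le_oneI, rule same) auto
      qed
      then have "g * C_comm P \<Gamma>' s \<le> g * 1" by (intro mult_left_mono) auto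
      then show ?thesis using True by simp
    next
      case False
      have "C_comm P \<Gamma>' s = 0" if "s \<ge> S"
        using that by (intro C_comm_eq_0[OF P]) (auto simp: \<Gamma>'_def)
      then show ?thesis using False by (cases "s < S") auto
    qed
    have "(\<Sum>s=1..S. g * C_comm P \<Gamma>' s) \<le> (\<Sum>s=1..S. if s < S then g else 0)"
      by (intro sum_mono comm)
    also have "\<dots> = g * (S - 1)"
    proof -
      have "{1..S} \<inter> {s. s < S} = {1..<S}" by auto
      then show ?thesis by (simp add: sum.If_cases)
    qed
    also have "\<dots> \<le> h * (S - 1)" using h by simp
    also have "\<dots> \<le> C"
    proof -
      \<comment> \<open>\<open>S\<close> is \<open>C / h\<close> rounded up, so \<open>S - 1\<close>
        full windows fit into \<open>C\<close>.\<close>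
      have "h * S \<le> C - 1 + h" by (simp add: S_def win_def)
      then show ?thesis using False by (simp add: diff_mult_distrib2)
    qed
    finally show ?thesis using work by (simp add: bsp_cost_def sum.distrib)
  qed
  ultimately show ?thesis using that C_def by blast
qed

subsection \<open>The general inequalities\<close>

lemma OPT_le:
  "spd_valid V E P g \<pi> t \<Gamma> \<Longrightarrow> OPT SPD V E P g \<le> spd_cost V t"
  "beta_valid V E P g \<pi> t \<Gamma> \<Longrightarrow> OPT BETA V E P g \<le> spd_cost V t"
  "mbsp_valid V E P S \<pi> \<tau> \<Gamma> \<Longrightarrow> OPT MBSP V E P g \<le> mbsp_cost V P g S \<pi> \<tau> \<Gamma>"
  "bsp_valid V E P S \<pi> \<tau> \<Gamma> \<Longrightarrow> OPT BSP V E P g \<le> bsp_cost V P g S \<pi> \<tau> \<Gamma>"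
  by (simp; rule Least_le; blast)+

text \<open>All nodes on one processor in one superstep form a valid schedule, so the minimum is
  attained. The other three models obtain a valid schedule by translating one of BSP.\<close>

lemma bsp_attained:
  assumes "dag V E" "P \<ge> 1"
  obtains S \<pi> \<tau> \<Gamma> where "bsp_valid V E P S \<pi> \<tau> \<Gamma>" "OPT BSP V E P g = bsp_cost V P g S \<pi> \<tau> \<Gamma>"
proof -
  have "bsp_valid V E P 1 (\<lambda>_. 1) (\<lambda>_. 1) {}"
    using assms by (auto simp: bsp_valid_def superstep_schedule_def)
  then have "\<exists>c S \<pi> \<tau> \<Gamma>. bsp_valid V E P S \<pi> \<tau> \<Gamma> \<and> c = bsp_cost V P g S \<pi> \<tau> \<Gamma>" by blast
  then have "\<exists>S \<pi> \<tau> \<Gamma>. bsp_valid V E P S \<pi> \<tau> \<Gamma> \<and> OPT BSP V E P g = bsp_cost V P g S \<pi> \<tau> \<Gamma>"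
    unfolding OPT.simps by (rule LeastI_ex)
  then show ?thesis using that by blast
qed

lemma mbsp_attained:
  assumes "dag V E" "P \<ge> 1"
  obtains S \<pi> \<tau> \<Gamma> where "mbsp_valid V E P S \<pi> \<tau> \<Gamma>" "OPT MBSP V E P g = mbsp_cost V P g S \<pi> \<tau> \<Gamma>"
proof -
  obtain S \<pi> \<tau> \<Gamma> where bsp: "bsp_valid V E P S \<pi> \<tau> \<Gamma>" by (rule bsp_attained[OF assms])
  obtain \<tau>' \<Gamma>' where "mbsp_valid V E P (2 * S) \<pi> \<tau>' \<Gamma>'" by (rule bsp_to_mbsp[OF assms(2) bsp])
  then have "\<exists>c S \<pi> \<tau> \<Gamma>. mbsp_valid V E P S \<pi> \<tau> \<Gamma> \<and> c = mbsp_cost V P g S \<pi> \<tau> \<Gamma>" by blast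
  then have "\<exists>S \<pi> \<tau> \<Gamma>. mbsp_valid V E P S \<pi> \<tau> \<Gamma> \<and> OPT MBSP V E P g = mbsp_cost V P g S \<pi> \<tau> \<Gamma>"
    unfolding OPT.simps by (rule LeastI_ex)
  then show ?thesis using that by blast
qed

lemma bsp_to_beta:
  assumes "dag V E" "P \<ge> 1" "bsp_valid V E P S \<pi> \<tau> \<Gamma>"
  obtains t \<Gamma>' where "beta_valid V E P g \<pi> t \<Gamma>'" "spd_cost V t \<le> bsp_cost V P g S \<pi> \<tau> \<Gamma>"
proof -
  obtain \<tau>' \<Gamma>' where 1: "mbsp_valid V E P (2 * S) \<pi> \<tau>' \<Gamma>'"
    "mbsp_cost V P g (2 * S) \<pi> \<tau>' \<Gamma>' \<le> bsp_cost V P g S \<pi> \<tau> \<Gamma>"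
    "\<And>v u p q. v \<in> V \<Longrightarrow> (u, p, q, \<tau>' v) \<notin> \<Gamma>'"
    by (rule bsp_to_mbsp[OF assms(2,3), of g]) blast
  obtain t \<Gamma>'' where "spd_cost V t \<le> mbsp_cost V P g (2 * S) \<pi> \<tau>' \<Gamma>'"
    "(\<And>v u p q. v \<in> V \<Longrightarrow> (u, p, q, \<tau>' v) \<notin> \<Gamma>') \<Longrightarrow> beta_valid V E P g \<pi> t \<Gamma>''"
    by (rule mbsp_to_spd[OF assms(1,2) 1(1), of g]) blast
  then show ?thesis using that 1(2,3) by (meson order.trans)
qed

lemma beta_attained:
  assumes "dag V E" "P \<ge> 1"
  obtains \<pi> t \<Gamma> where "beta_valid V E P g \<pi> t \<Gamma>" "OPT BETA V E P g = spd_cost V t"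
proof -
  obtain S \<pi> \<tau> \<Gamma> where bsp: "bsp_valid V E P S \<pi> \<tau> \<Gamma>" by (rule bsp_attained[OF assms])
  obtain t \<Gamma>' where "beta_valid V E P g \<pi> t \<Gamma>'" by (rule bsp_to_beta[OF assms bsp])
  then have "\<exists>c \<pi> t \<Gamma>. beta_valid V E P g \<pi> t \<Gamma> \<and> c = spd_cost V t" by blast
  then have "\<exists>\<pi> t \<Gamma>. beta_valid V E P g \<pi> t \<Gamma> \<and> OPT BETA V E P g = spd_cost V t"
    unfolding OPT.simps by (rule LeastI_ex)
  then show ?thesis using that by blast
qed

lemma spd_attained:
  assumes "dag V E" "P \<ge> 1"
  obtains \<pi> t \<Gamma> where "spd_valid V E P g \<pi> t \<Gamma>" "OPT SPD V E P g = spd_cost V t"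
proof -
  obtain \<pi> t \<Gamma> where "beta_valid V E P g \<pi> t \<Gamma>" by (rule beta_attained[OF assms])
  then have "\<exists>c \<pi> t \<Gamma>. spd_valid V E P g \<pi> t \<Gamma> \<and> c = spd_cost V t" unfolding beta_valid_def by blast
  then have "\<exists>\<pi> t \<Gamma>. spd_valid V E P g \<pi> t \<Gamma> \<and> OPT SPD V E P g = spd_cost V t"
    unfolding OPT.simps by (rule LeastI_ex)
  then show ?thesis using that by blast
qed

lemma OPT_order:
  assumes "dag V E" "P \<ge> 1"
  shows OPT_BSP_le_twice_SPD: "OPT BSP V E P g \<le> 2 * OPT SPD V E P g"
    and OPT_SPD_le_MBSP: "OPT SPD V E P g \<le> OPT MBSP V E P g"
    and OPT_MBSP_le_BSP: "OPT MBSP V E P g \<le> OPT BSP V E P g"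
    and OPT_SPD_le_BETA: "OPT SPD V E P g \<le> OPT BETA V E P g"
    and OPT_BETA_le_BSP: "OPT BETA V E P g \<le> OPT BSP V E P g"
proof -
  obtain \<pi> t \<Gamma> where spd: "spd_valid V E P g \<pi> t \<Gamma>" "OPT SPD V E P g = spd_cost V t"
    by (rule spd_attained[OF assms])
  obtain S \<tau> \<Gamma>' where "bsp_valid V E P S \<pi> \<tau> \<Gamma>'" "bsp_cost V P g S \<pi> \<tau> \<Gamma>' \<le> 2 * spd_cost V t"
    by (rule spd_to_bsp[OF assms spd(1)])
  then show "OPT BSP V E P g \<le> 2 * OPT SPD V E P g"
    using OPT_le(4) spd(2) by (metis order.trans)
next
  obtain S \<pi> \<tau> \<Gamma> where mbsp: "mbsp_valid V E P S \<pi> \<tau> \<Gamma>" "OPT MBSP V E P g = mbsp_cost V P g S \<pi> \<tau> \<Gamma>"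
    by (rule mbsp_attained[OF assms])
  obtain t \<Gamma>' where "spd_valid V E P g \<pi> t \<Gamma>'" "spd_cost V t \<le> mbsp_cost V P g S \<pi> \<tau> \<Gamma>"
    by (rule mbsp_to_spd[OF assms mbsp(1)])
  then show "OPT SPD V E P g \<le> OPT MBSP V E P g"
    using OPT_le(1) mbsp(2) by (metis order.trans)
next
  obtain \<pi> t \<Gamma> where "beta_valid V E P g \<pi> t \<Gamma>" "OPT BETA V E P g = spd_cost V t"
    by (rule beta_attained[OF assms])
  then show "OPT SPD V E P g \<le> OPT BETA V E P g"
    using OPT_le(1) unfolding beta_valid_def by metis
next
  obtain S \<pi> \<tau> \<Gamma> where bsp: "bsp_valid V E P S \<pi> \<tau> \<Gamma>" "OPT BSP V E P g = bsp_cost V P g S \<pi> \<tau> \<Gamma>"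
    by (rule bsp_attained[OF assms])
  obtain \<tau>' \<Gamma>' where "mbsp_valid V E P (2 * S) \<pi> \<tau>' \<Gamma>'"
    "mbsp_cost V P g (2 * S) \<pi> \<tau>' \<Gamma>' \<le> bsp_cost V P g S \<pi> \<tau> \<Gamma>"
    by (rule bsp_to_mbsp[OF assms(2) bsp(1)])
  then show "OPT MBSP V E P g \<le> OPT BSP V E P g"
    using OPT_le(3) bsp(2) by (metis order.trans)
  obtain t \<Gamma>' where "beta_valid V E P g \<pi> t \<Gamma>'" "spd_cost V t \<le> bsp_cost V P g S \<pi> \<tau> \<Gamma>"
    by (rule bsp_to_beta[OF assms bsp(1)])
  then show "OPT BETA V E P g \<le> OPT BSP V E P g"
    using OPT_le(2) bsp(2) by (metis order.trans)
qed

text \<open>BSP has the largest of the four optima and SPD the smallest.\<close>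

lemma OPT_le_twice_OPT:
  assumes "dag V E" "P \<ge> 1"
  shows "OPT X V E P g \<le> 2 * OPT Y V E P g"
proof -
  have "OPT X V E P g \<le> OPT BSP V E P g"
    using OPT_order[OF assms, of g] by (cases X) (auto simp del: OPT.simps)
  moreover have "OPT SPD V E P g \<le> OPT Y V E P g"
    using OPT_order[OF assms, of g] by (cases Y) (auto simp del: OPT.simps)
  ultimately show ?thesis using OPT_BSP_le_twice_SPD[OF assms, of g] by linarith
qed

subsection \<open>The factor 2: stars\<close>

text \<open>Reduces a ratio of optima to an upper bound \<open>a\<close> and a lower bound
  \<open>b\<close>. For \<open>c < \<epsilon>\<close> the factor is negative and the bound
  trivial.\<close>

lemma OPT_ratioI:
  fixes c \<epsilon> :: real
  assumes "OPT X V E P g \<le> a" "b \<le> OPT Y V E P g" "c * a - b \<le> \<epsilon> * a"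
  shows "real (OPT Y V E P g) \<ge> (c - \<epsilon>) * real (OPT X V E P g)"
proof (cases "c \<ge> \<epsilon>")
  case True
  then have "(c - \<epsilon>) * real (OPT X V E P g) \<le> (c - \<epsilon>) * real a"
    using assms(1) by (intro mult_left_mono) (auto simp del: OPT.simps)
  also have "\<dots> \<le> real b" using assms(3) by (simp add: algebra_simps)
  finally show ?thesis using assms(2) by linarith
next
  case False
  then have "(c - \<epsilon>) * real (OPT X V E P g) \<le> 0" by (intro mult_nonpos_nonneg) auto
  then show ?thesis by linarith
qed

text \<open>The centre is \<open>2 * T + 2\<close> so that the formulas for the leaves, processor
  \<open>v mod 2 + 1\<close> and superstep \<open>v div 2 + 1\<close>, also place the centre: on
  processor 1, in superstep \<open>T + 2\<close>.\<close>

definition star_nodes :: "nat \<Rightarrow> nat set" where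
  "star_nodes T = insert (2 * T + 2) {..<2 * T}"

definition star_edges :: "nat \<Rightarrow> nat rel" where
  "star_edges T = {..<2 * T} \<times> {2 * T + 2}"

lemma dagI_less:
  fixes V :: "nat set"
  assumes "finite V" "E \<subseteq> V \<times> V" "\<And>u v. (u, v) \<in> E \<Longrightarrow> u < v"
  shows "dag V E"
proof -
  have "E \<subseteq> {(u, v). u < v}" using assms(3) by auto
  then have "acyclic E" using acyclic_subset wf_acyclic[OF wf_less] by blast
  then show ?thesis using assms by (simp add: dag_def)
qed

lemma dag_star: "dag (star_nodes T) (star_edges T)"
  by (rule dagI_less) (auto simp: star_nodes_def star_edges_def)

text \<open>Leaves \<open>2 * i\<close> and \<open>2 * i + 1\<close> are computed in superstep
  \<open>i + 1\<close> on different processors; the odd one reaches processor 1 in superstep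
  \<open>i + 2\<close>, while the next pair is computed. So each superstep costs at most 1.\<close>

lemma OPT_MBSP_star_le: "OPT MBSP (star_nodes T) (star_edges T) 2 1 \<le> T + 2"
proof -
  define \<pi> where "\<pi> v = v mod 2 + 1" for v :: nat
  define \<tau> where "\<tau> v = v div 2 + 1" for v :: nat
  define \<Gamma> where "\<Gamma> = {(v, 2 :: nat, 1 :: nat, v div 2 + 2) | v. v < 2 * T \<and> odd v}"
  have "mbsp_valid (star_nodes T) (star_edges T) 2 (T + 2) \<pi> \<tau> \<Gamma>"
    unfolding mbsp_valid_def
  proof (intro conjI superstep_scheduleI)
    show "\<pi> v \<in> {1..2}" "\<tau> v \<in> {1..T + 2}" if "v \<in> star_nodes T" for v
      using that by (auto simp: \<pi>_def \<tau>_def star_nodes_def)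
    show "\<Gamma> \<subseteq> star_nodes T \<times> {1..2} \<times> {1..2} \<times> {1..T + 2}"
      by (auto simp: \<Gamma>_def star_nodes_def)
    show "\<tau> u \<le> \<tau> v" if "(u, v) \<in> star_edges T" for u v
      using that by (auto simp: \<tau>_def star_edges_def)
    show "\<exists>s. (u, \<pi> u, \<pi> v, s) \<in> \<Gamma> \<and> s < \<tau> v" if "(u, v) \<in> star_edges T" "\<pi> u \<noteq> \<pi> v" for u v
    proof -
      have "u < 2 * T" "v = 2 * T + 2" using that by (auto simp: star_edges_def)
      moreover have "odd u" using that calculation by (auto simp: \<pi>_def elim: evenE)
      ultimately have "(u, \<pi> u, \<pi> v, u div 2 + 2) \<in> \<Gamma>" "u div 2 + 2 < \<tau> v"
        by (auto simp: \<Gamma>_def \<pi>_def \<tau>_def odd_iff_mod_2_eq_one)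
      then show ?thesis by blast
    qed
    show "\<forall>(v, p1, p2, s)\<in>\<Gamma>. p1 = \<pi> v \<and> \<tau> v < s"
      by (auto simp: \<Gamma>_def \<pi>_def \<tau>_def odd_iff_mod_2_eq_one)
  qed
  moreover have "mbsp_cost (star_nodes T) 2 1 (T + 2) \<pi> \<tau> \<Gamma> \<le> T + 2"
  proof -
    have eq: "u = v" if "u div 2 = v div 2" "u mod 2 = v mod 2" for u v :: nat
      using that by (metis div_mult_mod_eq)
    have "C_work (star_nodes T) 2 \<pi> \<tau> s \<le> 1" for s
    proof (rule C_work_leI)
      fix p
      show "card {v \<in> star_nodes T. \<pi> v = p \<and> \<tau> v = s} \<le> 1"
      proof (rule card_le_oneI)
        fix u v assume "u \<in> {v \<in> star_nodes T. \<pi> v = p \<and> \<tau> v = s}"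
          and "v \<in> {v \<in> star_nodes T. \<pi> v = p \<and> \<tau> v = s}"
        then have "u div 2 = v div 2" "u mod 2 = v mod 2" by (simp_all add: \<pi>_def \<tau>_def)
        then show "u = v" by (rule eq)
      qed
    qed simp
    moreover have "C_comm 2 \<Gamma> s \<le> 1" for s
    proof (rule C_comm_leI)
      have "u = v" if "odd u" "odd v" "u div 2 = v div 2" for u v :: nat
        using that(1,2) by (intro eq[OF that(3)]) (simp add: odd_iff_mod_2_eq_one)
      then show "C_sent \<Gamma> s p \<le> 1" "C_rec \<Gamma> s p \<le> 1" for p
        unfolding C_sent_eq C_rec_eq by - (rule card_le_oneI; auto simp: \<Gamma>_def)+
    qed simp
    ultimately have "mbsp_cost (star_nodes T) 2 1 (T + 2) \<pi> \<tau> \<Gamma> \<le> (\<Sum>s=1..T + 2. 1)"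
      unfolding mbsp_cost_def by (intro sum_mono) simp
    then show ?thesis by simp
  qed
  ultimately show ?thesis using OPT_le(3) order.trans by blast
qed

text \<open>
  The processor of a common successor \<open>r\<close> of all other nodes either computes a node or spends a
  time unit on receiving it, and the alpha-beta model does not allow it to do both at once.
\<close>

lemma beta_sink_bound:
  assumes fin: "finite V" and valid: "beta_valid V E P 1 \<pi> t \<Gamma>"
    and r: "r \<in> V" "\<And>u. u \<in> V \<Longrightarrow> u \<noteq> r \<Longrightarrow> (u, r) \<in> E"
  shows "card V \<le> spd_cost V t"
proof -
  have "spd_valid V E P 1 \<pi> t \<Gamma>" using valid by (simp add: beta_valid_def)
  note spd = spd_validD[OF this]
  have busy: False if "(u, p, q, t0) \<in> \<Gamma>" "v \<in> V" "\<pi> v = q" "t v = t0 + 1" for u p q t0 v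
    using valid that unfolding beta_valid_def by fastforce
  have "\<exists>t0. \<pi> u \<noteq> \<pi> r \<longrightarrow> (u, \<pi> u, \<pi> r, t0) \<in> \<Gamma> \<and> t0 + 1 < t r" if "u \<in> V" for u
    using spd(8)[OF r(2)] that by (cases "u = r") auto
  then obtain t0 where t0: "\<And>u. \<lbrakk>u \<in> V; \<pi> u \<noteq> \<pi> r\<rbrakk> \<Longrightarrow> (u, \<pi> u, \<pi> r, t0 u) \<in> \<Gamma> \<and> t0 u + 1 < t r"
    by metis
  \<comment> \<open>The time unit that the processor of \<open>r\<close> spends on \<open>u\<close>:
    computing it, or receiving it, since for \<open>g = 1\<close> a transfer started at
    \<open>t0\<close> fills exactly unit \<open>t0 + 1\<close>.\<close>
  define slot where "slot u = (if \<pi> u = \<pi> r then t u else t0 u + 1)" for u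
  have "inj_on slot V"
  proof (rule inj_onI)
    fix u v assume uv: "u \<in> V" "v \<in> V" "slot u = slot v"
    consider "\<pi> u = \<pi> r" "\<pi> v = \<pi> r" | "\<pi> u \<noteq> \<pi> r" "\<pi> v \<noteq> \<pi> r"
      | "\<pi> u = \<pi> r" "\<pi> v \<noteq> \<pi> r" | "\<pi> u \<noteq> \<pi> r" "\<pi> v = \<pi> r" by blast
    then show "u = v"
    proof cases
      case 1
      then show ?thesis using uv spd(4) by (simp add: slot_def)
    next
      case 2
      then have "t0 u = t0 v" using uv by (simp add: slot_def)
      moreover have "(u, \<pi> u, \<pi> r, t0 u) = (v, \<pi> v, \<pi> r, t0 v)"
        by (rule spd(6)[of _ _ _ _ _ _ _ _ "t0 u + 1"]) (use t0[OF uv(1) 2(1)] t0[OF uv(2) 2(2)] calculation in auto)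
      ultimately show ?thesis by simp
    next
      case 3
      then show ?thesis using busy[of v "\<pi> v" "\<pi> r" "t0 v" u] t0 uv by (auto simp: slot_def)
    next
      case 4
      then show ?thesis using busy[of u "\<pi> u" "\<pi> r" "t0 u" v] t0 uv by (auto simp: slot_def)
    qed
  qed
  moreover have "slot ` V \<subseteq> {1..spd_cost V t}"
  proof -
    have "slot u \<in> {1..spd_cost V t}" if "u \<in> V" for u
      using t0[OF that] spd(2)[OF that] le_spd_cost[OF fin that, of t] le_spd_cost[OF fin r(1), of t]
      by (auto simp: slot_def)
    then show ?thesis by blast
  qed
  ultimately have "card V \<le> card {1..spd_cost V t}" by (intro card_inj_on_le) auto
  then show ?thesis by simp
qed

lemma OPT_BETA_star_ge: "2 * T + 1 \<le> OPT BETA (star_nodes T) (star_edges T) 2 1"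
proof -
  obtain \<pi> t \<Gamma> where valid: "beta_valid (star_nodes T) (star_edges T) 2 1 \<pi> t \<Gamma>"
    and opt: "OPT BETA (star_nodes T) (star_edges T) 2 1 = spd_cost (star_nodes T) t"
    by (rule beta_attained[OF dag_star[of T], of 2 1]) auto
  have "card (star_nodes T) \<le> spd_cost (star_nodes T) t"
    by (rule beta_sink_bound[OF _ valid, of "2 * T + 2"]) (auto simp: star_nodes_def star_edges_def)
  then show ?thesis unfolding opt by (simp add: star_nodes_def)
qed

lemma star_gap:
  fixes \<epsilon> :: real
  assumes \<epsilon>: "\<epsilon> > 0" and XY: "(X, Y) \<in> {(SPD, BETA), (SPD, BSP), (MBSP, BETA), (MBSP, BSP)}"
  shows "\<exists>P g (V :: nat set) E. P \<ge> 1 \<and> g \<ge> 1 \<and> dag V E \<and> V \<noteq> {} \<and>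
    real (OPT Y V E P g) \<ge> (2 - \<epsilon>) * real (OPT X V E P g)"
proof -
  \<comment> \<open>The constant 3 is \<open>2 * (T + 2) - (2 * T + 1)\<close>.\<close>
  obtain T :: nat where "3 / \<epsilon> \<le> T" using real_arch_simple by blast
  then have "3 \<le> \<epsilon> * real (T + 2)" using \<epsilon> by (simp add: field_simps add_increasing2)
  let ?V = "star_nodes T" and ?E = "star_edges T"
  note order = OPT_order[OF dag_star[of T], of 2 1]
  \<comment> \<open>In all four pairs the optimum of \<open>X\<close> is at most that of MBSP, and
    the optimum of \<open>Y\<close> at least that of BETA.\<close>
  have "OPT X ?V ?E 2 1 \<le> OPT MBSP ?V ?E 2 1" using order XY by auto
  then have "OPT X ?V ?E 2 1 \<le> T + 2" using OPT_MBSP_star_le[of T] by linarith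
  moreover have "OPT BETA ?V ?E 2 1 \<le> OPT Y ?V ?E 2 1" using order XY by auto
  then have "2 * T + 1 \<le> OPT Y ?V ?E 2 1" using OPT_BETA_star_ge[of T] by linarith
  ultimately have "real (OPT Y ?V ?E 2 1) \<ge> (2 - \<epsilon>) * real (OPT X ?V ?E 2 1)"
    by (rule OPT_ratioI) (use \<open>3 \<le> \<epsilon> * real (T + 2)\<close> in \<open>simp add: algebra_simps\<close>)
  moreover have "?V \<noteq> {}" by (simp add: star_nodes_def)
  ultimately show ?thesis using dag_star[of T] by (intro exI[of _ "2 :: nat"] exI[of _ "1 :: nat"]) auto
qed

subsection \<open>Lower bounds for maxBSP\<close>

lemma card_by_fibres:
  assumes "finite A" "finite I" "f ` A \<subseteq> I"
  shows "card A = (\<Sum>s\<in>I. card {u \<in> A. f u = s})"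
proof -
  have "(\<Sum>s\<in>I. \<Sum>x\<in>{u \<in> A. f u = s}. 1 :: nat) = (\<Sum>x\<in>A. 1)"
    by (rule sum.group) (use assms in auto)
  then show ?thesis by simp
qed

text \<open>
  Two adjacent nodes in the same superstep are on the same processor, so a superstep can hold only
  nodes of one processor out of a set of pairwise adjacent nodes.
\<close>

lemma clique_le_work:
  assumes fin: "finite V" and valid: "mbsp_valid V E P S \<pi> \<tau> \<Gamma>"
    and A: "A \<subseteq> V" "\<And>u v. \<lbrakk>u \<in> A; v \<in> A; u \<noteq> v\<rbrakk> \<Longrightarrow> (u, v) \<in> E \<or> (v, u) \<in> E"
    and I: "finite I" "\<tau> ` A \<subseteq> I"
  shows "card A \<le> (\<Sum>s\<in>I. C_work V P \<pi> \<tau> s)"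
proof -
  have "superstep_schedule V E P S \<pi> \<tau> \<Gamma>" using valid by (simp add: mbsp_valid_def)
  note sched = superstep_scheduleD[OF this]
  have snd: "\<tau> v < s" if "(v, p, q, s) \<in> \<Gamma>" for v p q s
    using valid that by (auto simp: mbsp_valid_def)
  \<comment> \<open>In maxBSP the message for an edge between processors lies strictly between the
    supersteps of its ends.\<close>
  have same: "\<pi> u = \<pi> v" if e: "(u, v) \<in> E" and "\<tau> u = \<tau> v" for u v
    using sched(5)[OF e] snd that(2) by fastforce
  have "card {u \<in> A. \<tau> u = s} \<le> C_work V P \<pi> \<tau> s" for s
  proof (cases "{u \<in> A. \<tau> u = s} = {}")
    case True
    then show ?thesis by (metis card.empty le0)
  next
    case False
    then obtain w where w: "w \<in> A" "\<tau> w = s" by blast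
    have "card {u \<in> A. \<tau> u = s} \<le> card {v \<in> V. \<pi> v = \<pi> w \<and> \<tau> v = s}"
    proof (rule card_mono)
      show "{u \<in> A. \<tau> u = s} \<subseteq> {v \<in> V. \<pi> v = \<pi> w \<and> \<tau> v = s}"
        using A w same by (force dest: A(2)[OF w(1)])
    qed (use fin in simp)
    also have "\<dots> \<le> C_work V P \<pi> \<tau> s" by (rule work_le_C_work) (use sched(1) A(1) w in blast)
    finally show ?thesis .
  qed
  then show ?thesis
    using card_by_fibres[OF finite_subset[OF A(1) fin] I] by (simp add: sum_mono)
qed

text \<open>Each value of \<open>X\<close> needs its own message to \<open>p\<close>, and the
  messages received by one processor number at most the sum of all \<open>C_comm\<close>.\<close>

lemma received_le_cost:
  assumes fin: "finite V" and valid: "mbsp_valid V E P S \<pi> \<tau> \<Gamma>" and p: "p \<in> {1..P}"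
    and X: "X \<subseteq> V" "\<And>u. u \<in> X \<Longrightarrow> \<pi> u \<noteq> p \<and> (\<exists>v. (u, v) \<in> E \<and> \<pi> v = p)"
  shows "g * card X \<le> mbsp_cost V P g S \<pi> \<tau> \<Gamma>"
proof -
  have sch: "superstep_schedule V E P S \<pi> \<tau> \<Gamma>" using valid by (simp add: mbsp_valid_def)
  note sched = superstep_scheduleD[OF sch]
  have "\<exists>s. (u, \<pi> u, p, s) \<in> \<Gamma>" if "u \<in> X" for u
    using X(2)[OF that] sched(5) by blast
  then obtain \<sigma> where \<sigma>: "\<And>u. u \<in> X \<Longrightarrow> (u, \<pi> u, p, \<sigma> u) \<in> \<Gamma>" by metis
  have "card {u \<in> X. \<sigma> u = s} \<le> C_comm P \<Gamma> s" for s
  proof -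
    have "card {u \<in> X. \<sigma> u = s} \<le> C_rec \<Gamma> s p"
      unfolding C_rec_eq
    proof (rule card_inj_on_le[of "\<lambda>u. (u, \<pi> u)"])
      show "finite {(v, q). (v, q, p, s) \<in> \<Gamma>}"
        by (rule finite_subset[of _ "V \<times> {1..P}"]) (use sched(3) fin in auto)
    qed (use \<sigma> in \<open>auto simp: inj_on_def\<close>)
    also have "\<dots> \<le> C_comm P \<Gamma> s" by (rule C_rec_le[OF p])
    finally show ?thesis .
  qed
  moreover have "\<sigma> ` X \<subseteq> {1..S}" using \<sigma> sched(3) by blast
  ultimately have "card X \<le> (\<Sum>s=1..S. C_comm P \<Gamma> s)"
    using card_by_fibres[OF finite_subset[OF X(1) fin], of "{1..S}" \<sigma>] by (simp add: sum_mono)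
  then have "g * card X \<le> (\<Sum>s=1..S. g * C_comm P \<Gamma> s)"
    unfolding sum_distrib_left[symmetric] by (rule mult_left_mono) simp
  also have "\<dots> \<le> mbsp_cost V P g S \<pi> \<tau> \<Gamma>"
    unfolding mbsp_cost_def by (intro sum_mono) simp
  finally show ?thesis .
qed

lemma proc_work_le_cost:
  assumes fin: "finite V" and valid: "mbsp_valid V E P S \<pi> \<tau> \<Gamma>" and p: "p \<in> {1..P}"
  shows "card {v \<in> V. \<pi> v = p} \<le> mbsp_cost V P g S \<pi> \<tau> \<Gamma>"
proof -
  have sch: "superstep_schedule V E P S \<pi> \<tau> \<Gamma>" using valid by (simp add: mbsp_valid_def)
  note sched = superstep_scheduleD[OF sch]
  have "card {v \<in> V. \<pi> v = p} = (\<Sum>s=1..S. card {u \<in> {v \<in> V. \<pi> v = p}. \<tau> u = s})"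
    by (rule card_by_fibres) (use fin sched(2) in auto)
  also have "\<dots> \<le> (\<Sum>s=1..S. C_work V P \<pi> \<tau> s)"
    using work_le_C_work[OF p, of V \<pi> \<tau>] by (intro sum_mono) simp
  also have "\<dots> \<le> mbsp_cost V P g S \<pi> \<tau> \<Gamma>"
    unfolding mbsp_cost_def by (intro sum_mono) simp
  finally show ?thesis .
qed

text \<open>
  The supersteps \<open>\<sigma> j\<close> cannot all coincide. If \<open>\<sigma> j < \<sigma> (j + 1)\<close> for some \<open>j\<close>, then two of them lie
  between the first \<open>j\<close> and the last \<open>g - j - 1\<close> units of cost; otherwise \<open>\<sigma> g \<le> \<sigma> 0\<close>.
\<close>

lemma sum_ge_of_staggered:
  fixes f \<sigma> :: "nat \<Rightarrow> nat"
  assumes \<sigma>: "\<And>j. j \<le> g \<Longrightarrow> \<sigma> j \<in> {1..S}" "\<And>j. j \<le> g \<Longrightarrow> g \<le> f (\<sigma> j)"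
    and pre: "\<And>j. j \<le> g \<Longrightarrow> j \<le> sum f {1..<\<sigma> j}"
    and post: "\<And>j. j \<le> g \<Longrightarrow> g - j \<le> sum f {\<sigma> j<..S}"
  shows "3 * g \<le> sum f {1..S} + 1"
proof (cases "\<exists>j<g. \<sigma> j < \<sigma> (Suc j)")
  case True
  then obtain j where j: "j < g" "\<sigma> j < \<sigma> (Suc j)" by blast
  \<comment> \<open>The parts amount to \<open>j\<close>, \<open>g\<close>, \<open>g\<close> and
    \<open>g - (j + 1)\<close>, in total \<open>3 * g - 1\<close>.\<close>
  have "sum f {1..<\<sigma> j} + (f (\<sigma> j) + (f (\<sigma> (Suc j)) + sum f {\<sigma> (Suc j)<..S})) =
      sum f ({1..<\<sigma> j} \<union> insert (\<sigma> j) (insert (\<sigma> (Suc j)) {\<sigma> (Suc j)<..S}))"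
    using j(2) by (subst sum.union_disjoint) auto
  also have "\<dots> \<le> sum f {1..S}"
    by (rule sum_mono2) (use j \<sigma>(1)[of j] \<sigma>(1)[of "Suc j"] in auto)
  finally show ?thesis
    using pre[of j] post[of "Suc j"] \<sigma>(2)[of j] \<sigma>(2)[of "Suc j"] j by linarith
next
  case False
  have "\<sigma> j \<le> \<sigma> 0" if "j \<le> g" for j
    using that
  proof (induction j)
    case (Suc j)
    then show ?case using False by (meson Suc_leD Suc_le_lessD leI order.trans)
  qed simp
  then have le: "\<sigma> g \<le> \<sigma> 0" by simp
  \<comment> \<open>There are \<open>g\<close> units before \<open>\<sigma> g\<close>,
    \<open>g\<close> in it, and \<open>g\<close> after \<open>\<sigma> 0\<close>.\<close>
  have "sum f {1..<\<sigma> g} + (f (\<sigma> g) + sum f {\<sigma> 0<..S}) =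
      sum f ({1..<\<sigma> g} \<union> insert (\<sigma> g) {\<sigma> 0<..S})"
    using le by (subst sum.union_disjoint) auto
  also have "\<dots> \<le> sum f {1..S}"
    by (rule sum_mono2) (use le \<sigma>(1)[of g] \<sigma>(1)[of 0] in auto)
  finally show ?thesis using pre[of g] post[of 0] \<sigma>(2)[of g] by simp
qed

subsection \<open>The factor 3/2: staggered threads\<close>

text \<open>One position for all three threads of a group, moved by one from group to group. The
  offset 5 exceeds the 2 + 2 values that two processors can receive at total cost below
  \<open>3 * g\<close>.\<close>

definition cut :: "nat \<Rightarrow> nat" where "cut \<theta> = \<theta> div 3 + 5"

text \<open>
  Node \<open>\<theta> * (g + 9) + a\<close> is the node at position \<open>a\<close> of thread \<open>\<theta>\<close>. The threads \<open>3 j, 3 j + 1, 3 j + 2\<close>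
  form group \<open>j\<close>. Every thread is a transitive tournament, and within group \<open>j\<close> the node at position
  \<open>cut (3 j) = j + 5\<close> precedes the nodes at later positions of the next thread.
\<close>

definition thread_nodes :: "nat \<Rightarrow> nat set" where
  "thread_nodes g = {..<3 * (g + 1) * (g + 9)}"

definition thread_edges :: "nat \<Rightarrow> nat rel" where
  "thread_edges g = {(u, v). v < 3 * (g + 1) * (g + 9) \<and>
     (u < v \<and> u div (g + 9) = v div (g + 9) \<or>
      v div (g + 9) = Suc (u div (g + 9)) \<and> v div (g + 9) mod 3 \<noteq> 0 \<and>
      u mod (g + 9) = cut (u div (g + 9)) \<and> cut (u div (g + 9)) < v mod (g + 9))}"

section \<open>Basic properties of the thread graph\<close>

lemma thread_edge_less:
  assumes "(u, v) \<in> thread_edges g" shows "u < v"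
proof (rule ccontr)
  assume "\<not> u < v"
  then have "v div (g + 9) \<le> u div (g + 9)" by (intro div_le_mono) simp
  then show False using assms \<open>\<not> u < v\<close> by (auto simp: thread_edges_def)
qed

lemma dag_thread: "dag (thread_nodes g) (thread_edges g)"
proof (rule dagI_less)
  show "thread_edges g \<subseteq> thread_nodes g \<times> thread_nodes g"
    using thread_edge_less by (fastforce simp: thread_edges_def thread_nodes_def)
qed (auto simp: thread_nodes_def dest: thread_edge_less)

lemma thread_index_less:
  "v \<in> thread_nodes g \<Longrightarrow> v div (g + 9) < 3 * (g + 1)"
  by (simp add: thread_nodes_def less_mult_imp_div_less)

lemma cut_le: "\<theta> < 3 * (g + 1) \<Longrightarrow> cut \<theta> \<le> g + 5"
  unfolding cut_def by (simp add: less_mult_imp_div_less div_less_iff_less_mult)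

lemma cut_Suc: "Suc \<theta> mod 3 \<noteq> 0 \<Longrightarrow> cut (Suc \<theta>) = cut \<theta>"
  unfolding cut_def by presburger

text \<open>Every thread has its own processor and pauses for \<open>g\<close> time units after its
  cut. The threads of a group pause together, which leaves room for their transfers, and
  \<open>g + 9\<close> nodes plus the pause take \<open>2 * g + 9\<close>.\<close>

lemma OPT_BETA_thread_le:
  "OPT BETA (thread_nodes g) (thread_edges g) (3 * (g + 1)) g \<le> 2 * g + 9"
proof -
  define L where "L = g + 9"
  define P where "P = 3 * (g + 1)"
  define \<pi> where "\<pi> v = v div L + 1" for v
  define t where "t v = (if v mod L \<le> cut (v div L) then v mod L + 1 else v mod L + 1 + g)" for v
  define \<Gamma> where "\<Gamma> = {(\<theta> * L + cut \<theta>, \<theta> + 1, \<theta> + 2, cut \<theta> + 1) | \<theta>. Suc \<theta> < P \<and> Suc \<theta> mod 3 \<noteq> 0}"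
  have L: "L > 0" by (simp add: L_def)
  have cutL: "cut \<theta> < L" if "\<theta> < P" for \<theta>
    using cut_le[of \<theta> g] that by (simp add: P_def L_def)
  have e: "(\<theta> * L + cut \<theta>) div L = \<theta>" "(\<theta> * L + cut \<theta>) mod L = cut \<theta>" if "\<theta> < P" for \<theta>
    using cutL[OF that] by simp_all
  have node: "\<theta> * L + a \<in> thread_nodes g" if "\<theta> < P" "a < L" for \<theta> a
  proof -
    have "\<theta> * L + a < Suc \<theta> * L" using that by simp
    also have "\<dots> \<le> P * L" using that by (intro mult_right_mono) auto
    finally show ?thesis by (simp add: thread_nodes_def P_def L_def)
  qed
  have "spd_valid (thread_nodes g) (thread_edges g) P g \<pi> t \<Gamma>"
  proof (rule spd_validI)
    show "\<pi> v \<in> {1..P}" if "v \<in> thread_nodes g" for v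
      using thread_index_less[OF that] by (simp add: \<pi>_def L_def P_def)
    show "1 \<le> t v" for v by (simp add: t_def)
    show "\<Gamma> \<subseteq> thread_nodes g \<times> {1..P} \<times> {1..P} \<times> {1..}"
      using node cutL by (auto simp: \<Gamma>_def)
    show "t u \<noteq> t v" if "u \<noteq> v" "\<pi> u = \<pi> v" for u v
    proof -
      have "u div L = v div L" using that(2) by (simp add: \<pi>_def)
      moreover from this have "u mod L \<noteq> v mod L" using that(1) by (metis div_mult_mod_eq)
      ultimately show ?thesis by (auto simp: t_def)
    qed
    show "t v \<le> t0" if "(v, p, q, t0) \<in> \<Gamma>" for v p q t0
      using that e by (auto simp: \<Gamma>_def t_def)
    \<comment> \<open>In the whole schedule each processor sends at most one message and receives at
      most one.\<close>
    show "p \<noteq> p' \<and> q \<noteq> q'"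
      if "(v, p, q, t1) \<in> \<Gamma>" "(v', p', q', t2) \<in> \<Gamma>" "(v, p, q, t1) \<noteq> (v', p', q', t2)"
      for v p q t1 v' p' q' t2
      using that by (auto simp: \<Gamma>_def)
    fix u v assume uv: "(u, v) \<in> thread_edges g"
    show "t u < t v" if "\<pi> u = \<pi> v"
    proof -
      have d: "u div L = v div L" using that by (simp add: \<pi>_def)
      moreover have "u < v" by (rule thread_edge_less[OF uv])
      ultimately have "u mod L < v mod L" by (metis div_mult_mod_eq nat_add_left_cancel_less)
      then show ?thesis using d by (auto simp: t_def)
    qed
    show "\<exists>t0. (u, \<pi> u, \<pi> v, t0) \<in> \<Gamma> \<and> t0 + g < t v" if "\<pi> u \<noteq> \<pi> v"
    proof -
      have v: "v div L = Suc (u div L)" "Suc (u div L) mod 3 \<noteq> 0" "u mod L = cut (u div L)"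
        "cut (u div L) < v mod L" and vN: "v \<in> thread_nodes g"
        using uv that by (auto simp: thread_edges_def \<pi>_def L_def thread_nodes_def)
      have "Suc (u div L) < P" using thread_index_less[OF vN] v(1) by (simp add: L_def P_def)
      moreover have "u = u div L * L + cut (u div L)" using v(3) by (metis div_mult_mod_eq)
      ultimately have "(u, \<pi> u, \<pi> v, cut (u div L) + 1) \<in> \<Gamma>"
        using v(1,2) unfolding \<Gamma>_def \<pi>_def by auto
      moreover have "cut (u div L) + 1 + g < t v" using v cut_Suc[OF v(2)] by (simp add: t_def)
      ultimately show ?thesis by blast
    qed
  qed
  moreover have False if m: "(u, p, q, t0) \<in> \<Gamma>" and v: "\<pi> v \<in> {p, q}" "t0 < t v" "t v \<le> t0 + g"
    for u p q t0 v
  proof -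
    obtain \<theta> where \<theta>: "Suc \<theta> mod 3 \<noteq> 0" "p = \<theta> + 1" "q = \<theta> + 2" "t0 = cut \<theta> + 1"
      using m by (auto simp: \<Gamma>_def)
    then have "cut (v div L) = cut \<theta>" using v(1) cut_Suc by (auto simp: \<pi>_def)
    then show False using v(2,3) \<theta> by (auto simp: t_def split: if_splits)
  qed
  ultimately have "beta_valid (thread_nodes g) (thread_edges g) P g \<pi> t \<Gamma>"
    unfolding beta_valid_def by blast
  moreover have "spd_cost (thread_nodes g) t \<le> 2 * g + 9"
  proof (rule spd_cost_le)
    show "t v \<le> 2 * g + 9" for v
    proof -
      have "v mod L < g + 9" using mod_less_divisor[OF L] unfolding L_def .
      then show ?thesis by (auto simp: t_def)
    qed
  qed (simp add: thread_nodes_def)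
  ultimately show ?thesis unfolding P_def[symmetric] using OPT_le(2) order.trans by blast
qed

text \<open>At smaller cost no processor receives three values, so all but two nodes of a thread are
  on the processor of its last node. A whole group on one processor would be too much work, hence
  some two consecutive threads of each group are apart. The superstep of the message between them is
  fed to \<open>sum_ge_of_staggered\<close>.\<close>

lemma thread_mbsp_cost_ge:
  assumes valid: "mbsp_valid (thread_nodes g) (thread_edges g) (3 * (g + 1)) S \<pi> \<tau> \<Gamma>"
  shows "3 * g \<le> mbsp_cost (thread_nodes g) (3 * (g + 1)) g S \<pi> \<tau> \<Gamma> + 1"
proof (rule ccontr)
  define P where "P = 3 * (g + 1)"
  define L where "L = g + 9"
  define V where "V = thread_nodes g"
  define E where "E = thread_edges g"
  define c where "c s = max (C_work V P \<pi> \<tau> s) (g * C_comm P \<Gamma> s)" for s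
  define T where "T = mbsp_cost V P g S \<pi> \<tau> \<Gamma>"
  assume "\<not> ?thesis"
  then have small: "T + 1 < 3 * g" by (simp add: T_def V_def P_def)
  have valid: "mbsp_valid V E P S \<pi> \<tau> \<Gamma>" using valid by (simp add: V_def E_def P_def)
  then have "superstep_schedule V E P S \<pi> \<tau> \<Gamma>" by (simp add: mbsp_valid_def)
  note sched = superstep_scheduleD[OF this]
  have snd: "\<tau> v < s" if "(v, p, q, s) \<in> \<Gamma>" for v p q s
    using valid that by (auto simp: mbsp_valid_def)
  have fin: "finite V" by (simp add: V_def thread_nodes_def)
  have L: "L > 0" by (simp add: L_def)
  have node: "\<theta> * L + a \<in> V" if "\<theta> < P" "a < L" for \<theta> a
  proof -
    have "\<theta> * L + a < Suc \<theta> * L" using that by simp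
    also have "\<dots> \<le> P * L" using that by (intro mult_right_mono) auto
    finally show ?thesis by (simp add: V_def thread_nodes_def P_def L_def)
  qed
  have dm: "(\<theta> * L + a) div L = \<theta>" "(\<theta> * L + a) mod L = a" if "a < L" for \<theta> a
    using that by simp_all
  have edge: "(\<theta> * L + a, \<theta> * L + b) \<in> E" if "\<theta> < P" "a < b" "b < L" for \<theta> a b
    using node[OF that(1,3)] dm[of a \<theta>] dm[of b \<theta>] that
    unfolding E_def V_def thread_edges_def thread_nodes_def L_def[symmetric] by simp
  have cross: "(\<theta> * L + cut \<theta>, Suc \<theta> * L + b) \<in> E"
    if "Suc \<theta> < P" "Suc \<theta> mod 3 \<noteq> 0" "cut \<theta> < b" "b < L" for \<theta> b
    using node[OF that(1,4)] dm[of "cut \<theta>" \<theta>] dm[of b "Suc \<theta>"] that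
    unfolding E_def V_def thread_edges_def thread_nodes_def L_def[symmetric] by simp
  have received: "card X \<le> 2" if "p \<in> {1..P}" "X \<subseteq> V"
    "\<And>u. u \<in> X \<Longrightarrow> \<pi> u \<noteq> p \<and> (\<exists>v. (u, v) \<in> E \<and> \<pi> v = p)" for p X
  proof (rule ccontr)
    assume "\<not> card X \<le> 2"
    then have "g * 3 \<le> g * card X" by (intro mult_left_mono) auto
    also have "\<dots> \<le> T" unfolding T_def by (rule received_le_cost[OF fin valid that])
    finally show False using small by simp
  qed
  \<comment> \<open>The home of a thread: its last node succeeds all its other nodes, so each of
    them computed elsewhere is received there.\<close>
  define \<rho> where "\<rho> \<theta> = \<pi> (\<theta> * L + (L - 1))" for \<theta>
  have \<rho>: "\<rho> \<theta> \<in> {1..P}" if "\<theta> < P" for \<theta>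
    unfolding \<rho>_def using that L by (intro sched(1) node) auto
  have to_last: "\<exists>v. (\<theta> * L + a, v) \<in> E \<and> \<pi> v = \<rho> \<theta>"
    if "\<theta> < P" "a < L" "\<pi> (\<theta> * L + a) \<noteq> \<rho> \<theta>" for \<theta> a
  proof -
    have "a \<noteq> L - 1" using that(3) by (auto simp: \<rho>_def)
    then have "(\<theta> * L + a, \<theta> * L + (L - 1)) \<in> E" using that by (intro edge) auto
    then show ?thesis by (auto simp: \<rho>_def)
  qed
  have "\<exists>\<theta>. Suc \<theta> < P \<and> Suc \<theta> mod 3 \<noteq> 0 \<and> cut \<theta> = j + 5 \<and> \<rho> \<theta> \<noteq> \<rho> (Suc \<theta>)" if j: "j \<le> g" for j
  proof (rule ccontr)
    assume not: "\<not> ?thesis"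
    have *: "3 * j + 2 < P" using j by (simp add: P_def)
    have "cut (3 * j) = j + 5" "cut (3 * j + 1) = j + 5" by (simp_all add: cut_def)
    moreover have "Suc (3 * j) mod 3 \<noteq> 0" "Suc (3 * j + 1) mod 3 \<noteq> 0" by presburger+
    ultimately have eq: "\<rho> (3 * j) = \<rho> (3 * j + 1)" "\<rho> (3 * j + 1) = \<rho> (3 * j + 2)"
      using not * by (metis Suc_eq_plus1 Suc_lessD add_2_eq_Suc' add_Suc_right)+
    define p where "p = \<rho> (3 * j)"
    have p: "p \<in> {1..P}" using \<rho>[of "3 * j"] * by (simp add: p_def)
    \<comment> \<open>The three threads of group \<open>j\<close>. At least
      \<open>3 * L - 2 = 3 * g + 25\<close> of these nodes would be on \<open>p\<close>.\<close>
    define B where "B = (\<lambda>k. 3 * j * L + k) ` {..<3 * L}"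
    have B: "u \<in> V \<and> (\<pi> u \<noteq> p \<longrightarrow> (\<exists>v. (u, v) \<in> E \<and> \<pi> v = p))" if u: "u \<in> B" for u
    proof -
      obtain k where k: "u = 3 * j * L + k" "k < 3 * L" using u by (auto simp: B_def)
      define i where "i = k div L"
      have "i < 3" using k L by (simp add: i_def less_mult_imp_div_less)
      then have "\<rho> (3 * j + i) = p" using eq by (auto simp: p_def less_Suc_eq numeral_3_eq_3 numeral_2_eq_2)
      moreover have "u = (3 * j + i) * L + k mod L" by (simp add: k i_def algebra_simps)
      moreover have "3 * j + i < P" using \<open>i < 3\<close> * by simp
      ultimately show ?thesis using node to_last[of "3 * j + i" "k mod L"] L by simp
    qed
    have finB: "finite B" by (simp add: B_def)
    have "card {u \<in> B. \<pi> u \<noteq> p} \<le> 2" by (rule received[OF p]) (use B in auto)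
    moreover have "card B = card {u \<in> B. \<pi> u \<noteq> p} + card {u \<in> B. \<pi> u = p}"
      using finB by (subst card_Un_disjoint[symmetric]) (auto intro: arg_cong[of _ _ card])
    moreover have "card B = 3 * L" by (simp add: B_def card_image)
    moreover have "card {u \<in> B. \<pi> u = p} \<le> card {v \<in> V. \<pi> v = p}"
      by (rule card_mono) (use B fin in auto)
    moreover have "\<dots> \<le> T" unfolding T_def by (rule proc_work_le_cost[OF fin valid p])
    ultimately show False using small by (simp add: L_def)
  qed
  then obtain th where th: "\<And>j. j \<le> g \<Longrightarrow> Suc (th j) < P \<and> Suc (th j) mod 3 \<noteq> 0 \<and> cut (th j) = j + 5 \<and>
    \<rho> (th j) \<noteq> \<rho> (Suc (th j))" by metis
  have clique: "card A \<le> sum c I"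
    if "\<theta> < P" and A: "A \<subseteq> (\<lambda>a. \<theta> * L + a) ` {..<L}" and I: "finite I" "\<tau> ` A \<subseteq> I" for A \<theta> I
  proof -
    have "card A \<le> (\<Sum>s\<in>I. C_work V P \<pi> \<tau> s)"
    proof (rule clique_le_work[OF fin valid _ _ I])
      show "A \<subseteq> V" using A node that(1) by auto
      fix u v assume "u \<in> A" "v \<in> A" "u \<noteq> v"
      moreover from this obtain a b where "u = \<theta> * L + a" "v = \<theta> * L + b" "a < L" "b < L"
        using A by blast
      ultimately show "(u, v) \<in> E \<or> (v, u) \<in> E"
        using edge[OF that(1)] by (metis nat_neq_iff)
    qed
    also have "\<dots> \<le> sum c I" by (rule sum_mono) (simp add: c_def)
    finally show ?thesis .
  qed
  have "\<exists>s. s \<in> {1..S} \<and> g \<le> c s \<and> j \<le> sum c {1..<s} \<and> g - j \<le> sum c {s<..S}" if j: "j \<le> g" for j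
  proof -
    define \<theta> where "\<theta> = th j"
    define m where "m = cut \<theta>"
    have \<theta>: "Suc \<theta> < P" "\<theta> < P" "Suc \<theta> mod 3 \<noteq> 0" "m = j + 5" "\<rho> \<theta> \<noteq> \<rho> (Suc \<theta>)"
      using th[OF j] by (auto simp: \<theta>_def m_def)
    define p where "p = \<rho> (Suc \<theta>)"
    have p: "p \<in> {1..P}" using \<rho>[OF \<theta>(1)] by (simp add: p_def)
    \<comment> \<open>From position \<open>m + 3 = j + 8\<close> on, a thread of length
      \<open>g + 9\<close> still has \<open>g - j + 1\<close> nodes.\<close>
    have mL: "m + 3 < L" using \<theta>(4) j by (simp add: L_def)
    define e where "e = \<theta> * L + m"
    \<comment> \<open>If \<open>e\<close> were on \<open>p\<close>, each of the
      \<open>m \<ge> 5\<close> nodes before it would be received by \<open>p\<close> or by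
      \<open>\<rho> \<theta>\<close>, but each of these two receives at most 2 values.\<close>
    have "\<pi> e \<noteq> p"
    proof
      assume ep: "\<pi> e = p"
      let ?A = "(\<lambda>a. \<theta> * L + a) ` {..<m}"
      have "card {u \<in> ?A. \<pi> u \<noteq> p} \<le> 2"
        by (rule received[OF p]) (use node[OF \<theta>(2)] edge[OF \<theta>(2)] mL ep e_def in fastforce)+
      moreover have "card {u \<in> ?A. \<pi> u = p} \<le> 2"
        by (rule received[OF \<rho>[OF \<theta>(2)]])
          (use node[OF \<theta>(2)] to_last[OF \<theta>(2)] mL \<theta>(5) p_def in fastforce)+
      moreover have "card ?A = card {u \<in> ?A. \<pi> u \<noteq> p} + card {u \<in> ?A. \<pi> u = p}"
        by (subst card_Un_disjoint[symmetric]) (auto intro: arg_cong[of _ _ card])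
      moreover have "card ?A = m" by (simp add: card_image)
      ultimately show False using \<theta>(4) by linarith
    qed
    \<comment> \<open>Otherwise all three of these nodes would be received by \<open>p\<close>, the
      home of their thread.\<close>
    have "\<exists>b\<in>{m + 1..m + 3}. \<pi> (Suc \<theta> * L + b) = p"
    proof (rule ccontr)
      assume none: "\<not> ?thesis"
      let ?A = "(\<lambda>a. Suc \<theta> * L + a) ` {m + 1..m + 3}"
      have "card ?A \<le> 2"
      proof (rule received[OF p])
        show "?A \<subseteq> V"
          by (rule image_subsetI, rule node[OF \<theta>(1)]) (use mL in simp)
        show "\<pi> u \<noteq> p \<and> (\<exists>v. (u, v) \<in> E \<and> \<pi> v = p)" if u: "u \<in> ?A" for u
        proof -
          obtain a where "u = Suc \<theta> * L + a" "a \<in> {m + 1..m + 3}" using u by blast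
          moreover from this have "\<pi> u \<noteq> p" using none by blast
          ultimately show ?thesis using to_last[OF \<theta>(1), of a] mL unfolding p_def by simp
        qed
      qed
      then show False by (simp add: card_image)
    qed
    then obtain b where b: "b \<in> {m + 1..m + 3}" "\<pi> (Suc \<theta> * L + b) = p" by blast
    have mb: "m < b" "b \<le> m + 3" using b(1) by simp_all
    have bL: "b < L" using mb mL by simp
    have "(e, Suc \<theta> * L + b) \<in> E"
      unfolding e_def m_def using mb(1) bL \<theta> by (intro cross) (auto simp: m_def)
    then obtain s where s: "(e, \<pi> e, p, s) \<in> \<Gamma>" "s < \<tau> (Suc \<theta> * L + b)"
      using sched(5) b(2) \<open>\<pi> e \<noteq> p\<close> by metis
    have mono: "\<tau> u \<le> \<tau> v" if "(u, v) \<in> E" for u v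
      using sched(4)[OF that] sched(5)[OF that] snd by fastforce
    have "s \<in> {1..S}" using s(1) sched(3) by auto
    moreover have "g \<le> c s"
    proof -
      have "finite {(v, q). (v, q, p, s) \<in> \<Gamma>}"
        by (rule finite_subset[of _ "V \<times> {1..P}"]) (use sched(3) fin in auto)
      then have "C_rec \<Gamma> s p \<noteq> 0" using s(1) by (auto simp: C_rec_eq)
      then have "1 \<le> C_comm P \<Gamma> s" using C_rec_le[OF p, of \<Gamma> s] by linarith
      then have "g * 1 \<le> g * C_comm P \<Gamma> s" by (intro mult_left_mono) auto
      then show ?thesis unfolding c_def by linarith
    qed
    \<comment> \<open>The \<open>m + 1\<close> nodes up to \<open>e\<close> are in supersteps before
      \<open>s\<close>; being a clique, those in one superstep are on one processor.\<close>
    moreover have "j \<le> sum c {1..<s}"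
    proof -
      let ?A = "(\<lambda>a. \<theta> * L + a) ` {..m}"
      have "card ?A \<le> sum c {1..<s}"
      proof (rule clique[OF \<theta>(2)])
        have "\<tau> u \<in> {1..<s}" if u: "u \<in> ?A" for u
        proof -
          obtain a where a: "u = \<theta> * L + a" "a \<le> m" using u by blast
          have "\<tau> u \<le> \<tau> e" using mono[OF edge[OF \<theta>(2), of a m]] a mL by (cases "a = m") (auto simp: e_def)
          moreover have "\<tau> u \<in> {1..S}" using a mL by (intro sched(2)) (auto intro: node[OF \<theta>(2)])
          ultimately show ?thesis using snd[OF s(1)] by simp
        qed
        then show "\<tau> ` ?A \<subseteq> {1..<s}" by blast
      qed (use mL in auto)
      then show ?thesis using \<theta>(4) by (simp add: card_image)
    qed
    \<comment> \<open>The same for the nodes of the receiving thread from position \<open>b\<close>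
      on, which come after superstep \<open>s\<close>.\<close>
    moreover have "g - j \<le> sum c {s<..S}"
    proof -
      let ?A = "(\<lambda>a. Suc \<theta> * L + a) ` {b..<L}"
      have "card ?A \<le> sum c {s<..S}"
      proof (rule clique[OF \<theta>(1)])
        have "\<tau> u \<in> {s<..S}" if u: "u \<in> ?A" for u
        proof -
          obtain a where u: "u = Suc \<theta> * L + a" and "a \<in> {b..<L}" using u by blast
          then have a: "b \<le> a" "a < L" by simp_all
          have "\<tau> (Suc \<theta> * L + b) \<le> \<tau> u" using mono[OF edge[OF \<theta>(1), of b a]] a u by (cases "a = b") auto
          moreover have "\<tau> u \<in> {1..S}" unfolding u by (intro sched(2) node[OF \<theta>(1)] a)
          ultimately show ?thesis using s(2) by simp
        qed
        then show "\<tau> ` ?A \<subseteq> {s<..S}" by blast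
        show "?A \<subseteq> (\<lambda>a. Suc \<theta> * L + a) ` {..<L}" by (rule image_mono) auto
      qed simp
      then show ?thesis using \<theta>(4) mb(2) by (simp add: card_image L_def)
    qed
    ultimately show ?thesis by blast
  qed
  then obtain \<sigma> where "\<And>j. j \<le> g \<Longrightarrow> \<sigma> j \<in> {1..S} \<and> g \<le> c (\<sigma> j) \<and> j \<le> sum c {1..<\<sigma> j} \<and>
    g - j \<le> sum c {\<sigma> j<..S}" by metis
  then have "3 * g \<le> sum c {1..S} + 1" by (intro sum_ge_of_staggered[of g \<sigma>]) blast+
  then show False using small by (simp add: T_def mbsp_cost_def c_def)
qed

lemma thread_gap:
  fixes \<epsilon> :: real
  assumes \<epsilon>: "\<epsilon> > 0" and XY: "(X, Y) \<in> {(SPD, MBSP), (BETA, BSP), (BETA, MBSP)}"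
  shows "\<exists>P g (V :: nat set) E. P \<ge> 1 \<and> g \<ge> 1 \<and> dag V E \<and> V \<noteq> {} \<and>
    real (OPT Y V E P g) \<ge> (3 / 2 - \<epsilon>) * real (OPT X V E P g)"
proof -
  \<comment> \<open>The constant 15 covers
    \<open>3 / 2 * (2 * g + 9) - (3 * g - 1) = 14.5\<close>.\<close>
  obtain g0 :: nat where "15 / \<epsilon> \<le> g0" using real_arch_simple by blast
  define g where "g = Suc g0"
  have "15 / \<epsilon> \<le> real (2 * g + 9)" using \<open>15 / \<epsilon> \<le> g0\<close> by (simp add: g_def)
  then have g: "15 \<le> \<epsilon> * real (2 * g + 9)" using \<epsilon> by (simp add: divide_le_eq mult.commute)
  let ?V = "thread_nodes g" and ?E = "thread_edges g" and ?P = "3 * (g + 1)"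
  have P: "?P \<ge> 1" by simp
  note order = OPT_order[OF dag_thread[of g] P, of g]
  obtain S \<pi> \<tau> \<Gamma> where "mbsp_valid ?V ?E ?P S \<pi> \<tau> \<Gamma>"
    and opt: "OPT MBSP ?V ?E ?P g = mbsp_cost ?V ?P g S \<pi> \<tau> \<Gamma>"
    by (rule mbsp_attained[OF dag_thread[of g] P, of g])
  then have "3 * g \<le> OPT MBSP ?V ?E ?P g + 1" using thread_mbsp_cost_ge by simp
  moreover have "OPT MBSP ?V ?E ?P g \<le> OPT Y ?V ?E ?P g" using order XY by auto
  ultimately have "3 * g - 1 \<le> OPT Y ?V ?E ?P g" by linarith
  moreover have "OPT X ?V ?E ?P g \<le> OPT BETA ?V ?E ?P g" using order XY by auto
  then have "OPT X ?V ?E ?P g \<le> 2 * g + 9" using OPT_BETA_thread_le[of g] by linarith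
  ultimately have "real (OPT Y ?V ?E ?P g) \<ge> (3 / 2 - \<epsilon>) * real (OPT X ?V ?E ?P g)"
    by (intro OPT_ratioI[where a = "2 * g + 9" and b = "3 * g - 1"])
      (use g in \<open>auto simp: g_def algebra_simps simp del: OPT.simps\<close>)
  moreover have "?V \<noteq> {}" by (simp add: thread_nodes_def lessThan_empty_iff)
  moreover have "g \<ge> 1" by (simp add: g_def)
  ultimately show ?thesis using dag_thread[of g] P by blast
qed

theorem theorem4p4:
  shows
    "(\<forall>(V :: 'a set) E P g. dag V E \<and> P \<ge> 1 \<longrightarrow>
        OPT BSP V E P g \<le> 2 * OPT SPD V E P g \<and>
        OPT SPD V E P g \<le> OPT MBSP V E P g \<and> OPT MBSP V E P g \<le> OPT BSP V E P g \<and>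
        OPT SPD V E P g \<le> OPT BETA V E P g \<and> OPT BETA V E P g \<le> OPT BSP V E P g \<and>
        (\<forall>X Y. OPT X V E P g \<le> 2 * OPT Y V E P g)) \<and>
     (\<forall>\<epsilon>::real. \<epsilon> > 0 \<longrightarrow>
        (\<forall>(X, Y) \<in> {(SPD, BETA), (SPD, BSP), (MBSP, BETA), (MBSP, BSP)}.
           \<exists>P g (V :: nat set) E. P \<ge> 1 \<and> g \<ge> 1 \<and> dag V E \<and> V \<noteq> {} \<and>
             real (OPT Y V E P g) \<ge> (2 - \<epsilon>) * real (OPT X V E P g)) \<and>
        (\<forall>(X, Y) \<in> {(SPD, MBSP), (BETA, BSP), (BETA, MBSP)}.
           \<exists>P g (V :: nat set) E. P \<ge> 1 \<and> g \<ge> 1 \<and> dag V E \<and> V \<noteq> {} \<and>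
             real (OPT Y V E P g) \<ge> (3 / 2 - \<epsilon>) * real (OPT X V E P g)))"
proof (intro conjI allI impI ballI)
  fix V :: "'a set" and E and P g :: nat and X Y
  assume "dag V E \<and> P \<ge> 1"
  then have "dag V E" "P \<ge> 1" by simp_all
  then show "OPT BSP V E P g \<le> 2 * OPT SPD V E P g" "OPT SPD V E P g \<le> OPT MBSP V E P g"
    "OPT MBSP V E P g \<le> OPT BSP V E P g" "OPT SPD V E P g \<le> OPT BETA V E P g"
    "OPT BETA V E P g \<le> OPT BSP V E P g" "OPT X V E P g \<le> 2 * OPT Y V E P g"
    by (fact OPT_order OPT_le_twice_OPT)+
next
  fix \<epsilon> :: real and XY :: "model \<times> model"
  assume \<epsilon>: "\<epsilon> > 0"
  obtain X Y where XY: "XY = (X, Y)" by (cases XY)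
  show "case XY of (X, Y) \<Rightarrow> \<exists>P g (V :: nat set) E. P \<ge> 1 \<and> g \<ge> 1 \<and> dag V E \<and> V \<noteq> {} \<and>
      real (OPT Y V E P g) \<ge> (2 - \<epsilon>) * real (OPT X V E P g)"
    if "XY \<in> {(SPD, BETA), (SPD, BSP), (MBSP, BETA), (MBSP, BSP)}"
    using star_gap[OF \<epsilon> that[unfolded XY]] unfolding XY prod.case .
  show "case XY of (X, Y) \<Rightarrow> \<exists>P g (V :: nat set) E. P \<ge> 1 \<and> g \<ge> 1 \<and> dag V E \<and> V \<noteq> {} \<and>
      real (OPT Y V E P g) \<ge> (3 / 2 - \<epsilon>) * real (OPT X V E P g)"
    if "XY \<in> {(SPD, MBSP), (BETA, BSP), (BETA, MBSP)}"
    using thread_gap[OF \<epsilon> that[unfolded XY]] unfolding XY prod.case .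
qed

end
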